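(* Let $d \in \mathbb{N}$ and $S \in \mathcal{S}^d(1)$ with $0 \in \operatorname{int}(S)$. Then \[ (d+1)^{d+1} \le (d!)^2 \operatorname{vol}(S)\operatorname{vol}(S^* ) \le (s_{d+1}-1)^2. \] The lower bound holds with equality if and only if the unique interior integral point $0$ of $S$ is the centroid of $S$; the upper bound holds with equality if and only if $S$ is unimodularly equivalent to $T^d_{1,d+1} = \operatorname{conv}(\{0,s_1e_1,\ldots,s_de_d\})$.
   Context: The Sylvester sequence: $s_1 = 2$, $s_i = \prod_{j=1}^{i-1} s_j + 1$ for $i\ge2$. $\mathcal{S}^d(1)$: $d$-dimensional simplices in $\mathbb{R}^d$ with integral vertices and exactly one interior integral point. $S^* = \{y : \langle x, y\rangle \le 1 \ \forall x \in S\}$ is the polar body. Unimodular equivalence: existence of an affine bijection of $\mathbb{R}^d$ preserving $\mathbb{Z}^d$ mapping one onto the other. *)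

theory Defs
  imports "HOL-Analysis.Analysis"
begin

text \<open>Sylvester sequence: s_n = (prod_{j=1}^{n-1} s_j) + 1 for n >= 1 (so s_1 = 2).
  The value at 0 is irrelevant.\<close>
function sylvester :: "nat \<Rightarrow> nat" where
  "sylvester n = (\<Prod>j\<in>{1..<n}. sylvester j) + 1"
  by auto
termination by (relation "Wellfounded.measure id") auto

definition integral_point :: "real^'n \<Rightarrow> bool" where
  "integral_point x \<longleftrightarrow> (\<forall>i. x $ i \<in> \<int>)"

definition lattice_simplex :: "(real^'n) set \<Rightarrow> bool" where
  "lattice_simplex S \<longleftrightarrow> (\<exists>V. finite V \<and> card V = CARD('n) + 1 \<and> \<not> affine_dependent V
      \<and> (\<forall>v\<in>V. integral_point v) \<and> S = convex hull V)"

definition simplices_one :: "(real^'n) set set" where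
  "simplices_one = {S. lattice_simplex S \<and> card {x \<in> interior S. integral_point x} = 1}"

definition polar :: "(real^'n) set \<Rightarrow> (real^'n) set" where
  "polar S = {y. \<forall>x\<in>S. inner x y \<le> 1}"

definition vol :: "(real^'n) set \<Rightarrow> real" where
  "vol S = measure lebesgue S"

definition centroid :: "(real^'n) set \<Rightarrow> real^'n" where
  "centroid S = (1 / vol S) *\<^sub>R integral S (\<lambda>x. x)"

definition unimod_equiv :: "(real^'n) set \<Rightarrow> (real^'n) set \<Rightarrow> bool" where
  "unimod_equiv S T \<longleftrightarrow> (\<exists>f. (\<exists>A b. f = (\<lambda>x. A *v x + b)) \<and> bij f
      \<and> f ` {x. integral_point x} = {x. integral_point x} \<and> f ` S = T)"

text \<open>T^d_{1,d+1} = conv{0, s_1 e_1, ..., s_d e_d}, where the coordinates of R^d are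
  enumerated by a bijection sigma from the index type to {1..d}.\<close>
definition T_simplex :: "('n \<Rightarrow> nat) \<Rightarrow> (real^'n) set" where
  "T_simplex \<sigma> = convex hull (insert 0 {real (sylvester (\<sigma> i)) *\<^sub>R axis i 1 | i. True})"

end

theory Submission
  imports Defs
begin

text \<open>
  Let \<open>\<beta>\<close> be the barycentric coordinates of the origin in S. Then
  \<open>(d!)\<^sup>2 vol(S) vol(S\<^sup>*) = 1 / (\<beta>\<^sub>1 \<cdots> \<beta>\<^bsub>d+1\<^esub>)\<close>, because the vertices of S and the facets of the polar
  simplex are governed by the same matrix. The lower bound is the inequality of arithmetic and
  geometric means. For the upper bound, Minkowski's theorem on linear forms turns a violation of
  \<open>\<Sum>\<^bsub>i\<in>J\<^esub> \<beta>\<^sub>i + \<Prod>\<^bsub>i\<in>J\<^esub> \<beta>\<^sub>i \<le> 1\<close> into a second interior integral point. For decreasing \<open>\<beta>\<close>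
  these inequalities imply that \<open>\<beta>\<close> is majorized by \<open>(1/s\<^sub>1, \<dots>, 1/s\<^sub>d, 1/(s\<^bsub>d+1\<^esub> - 1))\<close>, so the product
  of the \<open>\<beta>\<^sub>i\<close> is at least \<open>1/(s\<^bsub>d+1\<^esub> - 1)\<^sup>2\<close>, with equality only for this vector; this vector in turn
  determines S up to unimodular equivalence.
\<close>

section \<open>Linear change of variables\<close>

text \<open>The threshold in the inequality for J is a determinant: the linear forms have
  determinant 1 - \<Sum>\<beta> over J, the box prescribed for their values has sides with product
  \<Prod>\<beta> over J, and Minkowski's theorem applies as soon as the former is smaller. The
  Sylvester reciprocals attain equality on every initial segment, because 1/s_1 + ... + 1/s_k = 1 -
  1/(s_1 ... s_k). The constant is s_1 ... s_d = s_{d+1} - 1; it is squared because the last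
  coordinate 1/(s_1 ... s_d) repeats the product of the others. For the set of all d+1 vertices the
  inequality would be false, as the coordinates sum to 1. One vertex therefore has to be set aside,
  and majorization requires it to be the one with the smallest coordinate. This suits the matrices
  as well, which have d columns: the remaining d vertices are indexed by the coordinate type. Since
  that type has no order of its own, a bijection \<sigma> onto {1..d} carries the sorted sequence
  over to it.\<close>

lemma det_replace_row_with_updates:
  fixes u v :: "real^'n"
  assumes "finite F" "k \<notin> F"
  shows "det (\<chi> i. if i = k then v else if i \<in> F then axis i 1 + u $ i *\<^sub>R v else axis i 1) = v $ k"
  using assms
proof (induction F rule: finite_induct)
  case empty
  have "(\<chi> i. if i = k then v else axis i 1) = transpose (\<chi> i j. if j = k then (mat 1 *v v) $ i else mat 1 $ i $ j)"
    by (simp add: vec_eq_iff transpose_def axis_def) (simp add: mat_def eq_commute)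
  then show ?case
    using cramer_lemma [where A = "mat 1" and k = k and x = v]
    by (simp add: det_transpose del: matrix_vector_mul_lid cong: if_cong)
next
  case (insert j F)
  define B where "B = (\<lambda>i. if i = k then v else if i \<in> F then axis i 1 + u $ i *\<^sub>R v else axis i 1)"
  have jk: "j \<noteq> k" "j \<notin> F" "k \<notin> F"
    using insert by auto
  have "(\<chi> i. if i = k then v else if i \<in> insert j F then axis i 1 + u $ i *\<^sub>R v else axis i 1)
      = (\<chi> i. if i = j then axis j 1 + u $ j *s v else B i)"
    using jk by (auto simp: vec_eq_iff B_def)
  moreover have "det (\<chi> i. if i = j then axis j 1 else B i) = v $ k"
  proof -
    have "(\<chi> i. if i = j then axis j 1 else B i) = (\<chi> i. B i)"
      using jk by (auto simp: vec_eq_iff B_def)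
    then show ?thesis
      using insert.IH jk by (simp add: B_def)
  qed
  moreover have "det (\<chi> i. if i = j then v else B i) = 0"
    by (rule det_identical_rows [OF jk(1)]) (use jk in \<open>auto simp: row_def B_def\<close>)
  ultimately show ?case
    by (simp add: det_row_add det_row_mul)
qed

text \<open>Matrix determinant lemma, det(I + u v^T) = 1 + u.v. The rows are updated one at a time:
  multilinearity in row k adds \<open>u $ k\<close> times a determinant whose row k is v, where the
  multiples of v in the other rows drop out. The formula evaluates shears, exchanges of simplex
  vertices, the edge matrix and the linear forms for Minkowski's theorem.\<close>

lemma det_rank_one_update:
  fixes u v :: "real^'n"
  shows "det (\<chi> i j. (if i = j then 1 else 0) + u $ i * v $ j) = 1 + (\<Sum>i\<in>UNIV. u $ i * v $ i)"
proof -
  have "det (\<chi> i. if i \<in> F then axis i 1 + u $ i *\<^sub>R v else axis i 1) = 1 + (\<Sum>i\<in>F. u $ i * v $ i)"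
    if "finite F" for F
    using that
  proof (induction F rule: finite_induct)
    case empty
    have "(\<chi> i. axis i 1) = (mat 1 :: real^'n^'n)"
      by (auto simp: vec_eq_iff axis_def mat_def)
    then show ?case
      by simp
  next
    case (insert k F)
    define B where "B = (\<lambda>i. if i \<in> F then axis i 1 + u $ i *\<^sub>R v else axis i 1)"
    have "(\<chi> i. if i \<in> insert k F then axis i 1 + u $ i *\<^sub>R v else axis i 1)
      = (\<chi> i. if i = k then axis k 1 + u $ k *s v else B i)"
      by (auto simp: vec_eq_iff B_def)
    moreover have "(\<chi> i. if i = k then axis k 1 else B i) = (\<chi> i. B i)"
      using insert by (auto simp: vec_eq_iff B_def)
    moreover have "det (\<chi> i. if i = k then v else B i) = v $ k"
      unfolding B_def using det_replace_row_with_updates [of F k v u] insert by simp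
    ultimately show ?case
      using insert by (simp add: det_row_add det_row_mul) (simp add: B_def)
  qed
  from this [of UNIV] show ?thesis
    by (simp add: axis_def vec_eq_iff plus_vec_def scaleR_vec_def eq_commute if_distrib cong: if_cong)
qed

lemma measure_shear_cbox:
  fixes a b :: "real^'n"
  assumes "m \<noteq> n"
  shows "measure lebesgue ((\<lambda>x. \<chi> i. if i = m then x $ m + x $ n else x $ i) ` cbox a b)
       = measure lebesgue (cbox a b)"
proof (cases "cbox a b = {}")
  case False
  let ?h = "\<lambda>x::real^'n. \<chi> i. if i = m then x $ m + x $ n else x $ i"
  \<comment> \<open>Translation by \<open>w\<close> moves the n-th coordinate of the lower corner to
    0; \<open>measure_shear_interval\<close> asks for a nonnegative one.\<close>
  define w :: "real^'n" where "w = axis n (- a $ n)"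
  have "?h ` (cbox (w + a) (w + b)) = (+) (?h w) ` (?h ` cbox a b)"
    unfolding cbox_translation image_image by (intro image_cong) (auto simp: vec_eq_iff)
  then have "measure lebesgue (?h ` cbox a b) = measure lebesgue (?h ` (cbox (w + a) (w + b)))"
    by (simp add: measure_translation)
  also have "\<dots> = measure lebesgue (cbox (w + a) (w + b))"
    using False assms by (intro measure_shear_interval) (auto simp: cbox_translation w_def)
  also have "\<dots> = measure lebesgue (cbox a b)"
    by (metis cbox_translation measure_translation)
  finally show ?thesis .
qed simp

lemma measure_coordinate_swap_cbox:
  fixes a b :: "real^'n"
  shows "measure lebesgue ((\<lambda>x. \<chi> i. x $ Transposition.transpose m n i) ` cbox a b)
       = measure lebesgue (cbox a b)"
proof (cases "cbox a b = {}")
  case False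
  let ?t = "Transposition.transpose m n"
  let ?h = "\<lambda>x::real^'n. \<chi> i. x $ ?t i"
  have "?h ` cbox a b = cbox (?h a) (?h b)"
  proof (intro subset_antisym subsetI)
    fix x assume "x \<in> cbox (?h a) (?h b)"
    then have "?h x \<in> cbox a b"
      by (simp add: mem_box_cart) (metis transpose_involutory)
    moreover have "x = ?h (?h x)"
      by (simp add: vec_eq_iff)
    ultimately show "x \<in> ?h ` cbox a b"
      by (rule rev_image_eqI)
  qed (auto simp: mem_box_cart)
  moreover have "(\<Prod>i\<in>UNIV. b $ ?t i - a $ ?t i) = (\<Prod>i\<in>UNIV. b $ i - a $ i)"
    using prod.reindex_bij_betw [of ?t UNIV UNIV "\<lambda>i. b $ i - a $ i"] by simp
  moreover have "cbox (?h a) (?h b) \<noteq> {}"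
    using False calculation(1) by auto
  ultimately show ?thesis
    using False by (simp add: content_cbox_cart)
qed simp

text \<open>Treating a shear as a rank-one update avoids the well-ordered index type that
  \<open>measure_linear_image\<close> needs for its triangular determinants.\<close>
lemma measure_linear_image_finite:
  fixes f :: "real^'n \<Rightarrow> real^'n"
  assumes "linear f" "S \<in> lmeasurable"
  shows "f ` S \<in> lmeasurable \<and> measure lebesgue (f ` S) = \<bar>det (matrix f)\<bar> * measure lebesgue S"
proof -
  let ?P = "\<lambda>f. \<forall>S::(real^'n) set. S \<in> lmeasurable \<longrightarrow>
      f ` S \<in> lmeasurable \<and> measure lebesgue (f ` S) = \<bar>det (matrix f)\<bar> * measure lebesgue S"
  have unimodular: "?P f"
    if "linear f" "\<bar>det (matrix f)\<bar> = 1" "\<And>a b. measure lebesgue (f ` cbox a b) = measure lebesgue (cbox a b)"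
    for f :: "real^'n \<Rightarrow> real^'n"
  proof (intro allI impI)
    fix S :: "(real^'n) set"
    assume "S \<in> lmeasurable"
    from measure_linear_sufficient [OF that(1) this, of 1] that(2,3)
    show "f ` S \<in> lmeasurable \<and> measure lebesgue (f ` S) = \<bar>det (matrix f)\<bar> * measure lebesgue S"
      by simp
  qed
  have "?P f"
  proof (rule induct_linear_elementary [OF \<open>linear f\<close>])
    fix f g :: "real^'n \<Rightarrow> real^'n"
    assume "linear f" "linear g" "?P f" "?P g"
    then show "?P (f \<circ> g)"
      by (simp only: image_comp [symmetric] matrix_compose det_mul abs_mult) (simp add: mult.assoc)
  next
    fix f :: "real^'n \<Rightarrow> real^'n" and i
    assume f: "linear f" "\<And>x. f x $ i = 0"
    have "\<not> surj f"
      using f(2) by (metis (full_types) one_neq_zero surjE vec_component)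
    then have "\<not> inj f"
      using f(1) linear_injective_imp_surjective by blast
    then have "det (matrix f) = 0" and "negligible (f ` S)" for S
      using f(1) det_nz_iff_inj negligible_linear_singular_image by blast+
    then show "?P f"
      by (simp add: negligible_iff_measure)
  next
    fix c :: "'n \<Rightarrow> real"
    have "det (matrix (\<lambda>x. \<chi> i. c i * x $ i)) = prod c UNIV"
      by (subst det_diagonal) (auto simp: matrix_def axis_def)
    then show "?P (\<lambda>x. \<chi> i. c i * x $ i)"
      by (simp add: measurable_stretch measure_stretch)
  next
    fix m n :: 'n
    assume "m \<noteq> n"
    let ?h = "\<lambda>x::real^'n. \<chi> i. x $ Transposition.transpose m n i"
    have "matrix ?h = (\<chi> i. mat 1 $ Transposition.transpose m n i)"
      by (auto simp: vec_eq_iff matrix_def axis_def mat_def)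
    then have "\<bar>det (matrix ?h)\<bar> = 1"
      by (simp add: det_permute_rows permutes_swap_id sign_swap_id abs_mult)
    then show "?P ?h"
      by (intro unimodular measure_coordinate_swap_cbox linearI) (auto simp: vec_eq_iff)
  next
    fix m n :: 'n
    assume mn: "m \<noteq> n"
    let ?h = "\<lambda>x::real^'n. \<chi> i. if i = m then x $ m + x $ n else x $ i"
    have "matrix ?h = (\<chi> i j. (if i = j then 1 else 0) + axis m 1 $ i * axis n 1 $ j)"
      using mn by (auto simp: vec_eq_iff matrix_def axis_def)
    then have "det (matrix ?h) = 1"
      using mn by (simp only: det_rank_one_update) (auto simp: axis_def intro!: sum.neutral)
    then show "?P ?h"
      using mn by (intro unimodular measure_shear_cbox linearI) (auto simp: vec_eq_iff algebra_simps)
  qed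
  then show ?thesis
    using assms(2) by blast
qed

text \<open>Stated as an identity of measures, the change of variables yields both integrals over
  images and measures of preimages. It is enough to compare open boxes: their preimage under A is
  the image under the inverse B, and |det A| |det B| = 1.\<close>

lemma lborel_linear:
  fixes A :: "real^'n^'n"
  assumes "det A \<noteq> 0"
  shows "lborel = density (distr lborel borel ((*v) A)) (\<lambda>_. ennreal \<bar>det A\<bar>)"
proof (rule lborel_eqI)
  have meas: "(*v) A \<in> lborel \<rightarrow>\<^sub>M borel"
    by (simp add: borel_measurable_continuous_onI linear_continuous_on linear_linear)
  obtain B where AB: "A ** B = mat 1" "B ** A = mat 1"
    using assms invertible_det_nz [of A] by (auto simp: invertible_def)
  fix l u :: "real^'n"
  assume "\<And>b. b \<in> Basis \<Longrightarrow> l \<bullet> b \<le> u \<bullet> b"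
  then have vol: "measure lebesgue (box l u) = (\<Prod>b\<in>Basis. (u - l) \<bullet> b)"
    by (simp add: measure_lborel_box_eq)
  have pre: "(*v) A -` box l u = (*v) B ` box l u"
    using AB by (force simp: matrix_vector_mul_assoc image_iff)
  have lin: "linear ((*v) B)"
    by simp
  have "(*v) B ` box l u \<in> lmeasurable"
    "measure lebesgue ((*v) B ` box l u) = \<bar>det B\<bar> * measure lebesgue (box l u)"
    using measure_linear_image_finite [OF lin, of "box l u"] by auto
  then have "emeasure lebesgue ((*v) B ` box l u) = ennreal (\<bar>det B\<bar> * measure lebesgue (box l u))"
    by (metis emeasure_eq_measure2)
  moreover have "\<bar>det A\<bar> * \<bar>det B\<bar> = 1"
    by (metis AB(1) abs_mult abs_one det_I det_mul)
  moreover have "(*v) A -` box l u \<in> sets borel"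
    using measurable_sets [OF meas, of "box l u"] by simp
  ultimately show "emeasure (density (distr lborel borel ((*v) A)) (\<lambda>_. ennreal \<bar>det A\<bar>)) (box l u)
      = (\<Prod>b\<in>Basis. (u - l) \<bullet> b)"
    using meas
    by (simp add: emeasure_density nn_integral_cmult emeasure_distr pre vol)
      (simp add: mult.assoc [symmetric] flip: ennreal_mult')
qed simp

section \<open>Extremality of the Sylvester sequence\<close>

declare sylvester.simps [simp del]

lemma sylvester_Suc: "sylvester (Suc n) = (\<Prod>j=1..n. sylvester j) + 1"
  by (subst sylvester.simps) (simp add: atLeastLessThanSuc_atLeastAtMost)

lemma sylvester_pos: "0 < sylvester n"
  by (subst sylvester.simps) simp

text \<open>Telescoping: for P = s_1 ... s_n the next term is P + 1, and 1/P - 1/(P + 1) = 1/(P (P +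
  1)).\<close>

lemma sum_inverse_sylvester:
  "(\<Sum>i=1..n. 1 / real (sylvester i)) = 1 - 1 / (\<Prod>i=1..n. real (sylvester i))"
proof (induction n)
  case (Suc n)
  define P where "P = (\<Prod>i=1..n. real (sylvester i))"
  have "P > 0"
    unfolding P_def by (intro prod_pos) (simp add: sylvester_pos)
  moreover have "real (sylvester (Suc n)) = P + 1"
    by (simp add: sylvester_Suc P_def)
  moreover have "(\<Prod>i=1..Suc n. real (sylvester i)) = P * real (sylvester (Suc n))"
    by (simp add: P_def)
  moreover have "(\<Sum>i=1..Suc n. 1 / real (sylvester i)) = 1 - 1 / P + 1 / real (sylvester (Suc n))"
    using Suc by (simp add: P_def)
  moreover have "1 / P - 1 / (P + 1) = 1 / (P * (P + 1))"
    using \<open>P > 0\<close> by (simp add: divide_simps)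
  ultimately show ?case
    by simp
qed simp

text \<open>Follows from ln t \<le> t - 1, which is tight only at t = 1. Both bounds and the
  uniqueness in their equality cases rest on it: t is d+1 times a barycentric coordinate for the
  lower bound, and the ratio of the extremal to the actual coordinate for the upper one.\<close>

lemma prod_le_1_of_sum_minus_1:
  fixes t :: "'a \<Rightarrow> real"
  assumes "finite I" and pos: "\<And>i. i \<in> I \<Longrightarrow> 0 < t i" and sum: "(\<Sum>i\<in>I. t i - 1) \<le> 0"
  shows "prod t I \<le> 1" and "prod t I = 1 \<Longrightarrow> i \<in> I \<Longrightarrow> t i = 1"
proof -
  have ln: "ln (prod t I) = (\<Sum>i\<in>I. ln (t i))"
    by (intro ln_prod) (use assms in \<open>force+\<close>)
  have le: "ln (t i) \<le> t i - 1" if "i \<in> I" for i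
    using pos that by (intro ln_le_minus_one) auto
  have prod_pos: "0 < prod t I"
    using pos by (intro prod_pos) auto
  have "ln (prod t I) \<le> (\<Sum>i\<in>I. t i - 1)"
    unfolding ln by (intro sum_mono le)
  with sum prod_pos show "prod t I \<le> 1"
    by (meson ln_le_zero_iff order_trans)
  assume "prod t I = 1" "i \<in> I"
  then have "(\<Sum>i\<in>I. (t i - 1) - ln (t i)) \<le> 0"
    using sum ln by (simp add: sum_subtractf)
  moreover have nonneg: "0 \<le> (t i - 1) - ln (t i)" if "i \<in> I" for i
    using le that by simp
  ultimately have "(\<Sum>i\<in>I. (t i - 1) - ln (t i)) = 0"
    by (intro antisym sum_nonneg)
  then have "(t i - 1) - ln (t i) = 0"
    using sum_nonneg_eq_0_iff [OF \<open>finite I\<close> nonneg] \<open>i \<in> I\<close> by simp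
  then show "t i = 1"
    using pos \<open>i \<in> I\<close> by (intro ln_eq_minus_one) auto
qed

text \<open>Summation by parts. Weights of either sign occur: x itself in the comparison of sums and
  -1/x in the comparison of products, both decreasing when x is.\<close>

lemma Abel_sum_ge:
  fixes c d :: "nat \<Rightarrow> real"
  assumes "m \<le> n"
    and "\<And>k. m \<le> k \<Longrightarrow> k < n \<Longrightarrow> c (Suc k) \<le> c k"
    and "\<And>k. m \<le> k \<Longrightarrow> k < n \<Longrightarrow> 0 \<le> (\<Sum>i=m..k. d i)"
  shows "c n * (\<Sum>i=m..n. d i) \<le> (\<Sum>i=m..n. c i * d i)"
  using assms
proof (induction n rule: dec_induct)
  case (step n)
  have "c (Suc n) * (\<Sum>i=m..n. d i) \<le> c n * (\<Sum>i=m..n. d i)"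
    using step by (intro mult_right_mono) auto
  also have "\<dots> \<le> (\<Sum>i=m..n. c i * d i)"
    using step by auto
  finally show ?case
    using step by (simp add: algebra_simps)
qed simp

text \<open>Soundararajan's argument: if the sum of the \<open>x\<^sub>i\<close> were larger than that of the \<open>1 / s\<^sub>i\<close>, the
  product would be smaller. In the shortest final block whose product is smaller, all initial
  products are at most the corresponding Sylvester products, and therefore so is its sum.\<close>
lemma sum_le_sum_inverse_sylvester:
  fixes x :: "nat \<Rightarrow> real"
  assumes pos: "\<And>i. 1 \<le> i \<Longrightarrow> i \<le> n \<Longrightarrow> 0 < x i"
    and decr: "\<And>i. 1 \<le> i \<Longrightarrow> i < n \<Longrightarrow> x (Suc i) \<le> x i"
    and sum_prod: "\<And>k. 1 \<le> k \<Longrightarrow> k \<le> n \<Longrightarrow> (\<Sum>i=1..k. x i) + (\<Prod>i=1..k. x i) \<le> 1"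
  shows "k \<le> n \<Longrightarrow> (\<Sum>i=1..k. x i) \<le> (\<Sum>i=1..k. 1 / real (sylvester i))"
proof (induction k rule: less_induct)
  case (less k)
  define y where "y = (\<lambda>i. 1 / real (sylvester i))"
  define d where "d = (\<lambda>i. ln (y i) - ln (x i))"
  have y_pos: "0 < y i" for i
    by (simp add: y_def sylvester_pos)
  show ?case
  proof (rule ccontr)
    assume "\<not> ?thesis"
    then have gt: "(\<Sum>i=1..k. y i) < (\<Sum>i=1..k. x i)"
      by (simp add: y_def)
    have k: "1 \<le> k"
      using gt by (cases k) auto
    have xpos: "0 < x i" if "i \<in> {1..k}" for i
      using pos that less.prems by auto
    \<comment> \<open>For y, sum plus product is exactly 1, for x it is at most 1; so a larger sum
      forces a smaller product.\<close>
    have "(\<Prod>i=1..k. x i) < (\<Prod>i=1..k. y i)"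
      using sum_prod [OF k less.prems] gt sum_inverse_sylvester [of k]
      by (simp add: y_def prod_dividef)
    then have "ln (\<Prod>i=1..k. x i) < ln (\<Prod>i=1..k. y i)"
      using xpos y_pos by (subst ln_less_cancel_iff) (auto intro!: prod_pos)
    moreover have "ln (\<Prod>i=1..k. x i) = (\<Sum>i=1..k. ln (x i))"
      by (intro ln_prod) (use xpos in force)+
    moreover have "ln (\<Prod>i=1..k. y i) = (\<Sum>i=1..k. ln (y i))"
      using y_pos by (intro ln_prod) (auto simp: less_imp_neq [symmetric])
    ultimately have "0 < (\<Sum>i=1..k. d i)"
      by (simp add: d_def sum_subtractf)
    define J where "J = {j \<in> {1..k}. 0 < (\<Sum>i=j..k. d i)}"
    have "finite J" "J \<noteq> {}"
      using k \<open>0 < (\<Sum>i=1..k. d i)\<close> by (auto simp: J_def)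
    define j where "j = Max J"
    have "j \<in> J"
      using \<open>finite J\<close> \<open>J \<noteq> {}\<close> by (simp add: j_def)
    then have j: "1 \<le> j" "j \<le> k" "0 < (\<Sum>i=j..k. d i)"
      by (auto simp: J_def)
    \<comment> \<open>Otherwise the block starting at \<open>Suc l\<close> would have a positive sum
      too, against the maximality of j.\<close>
    have initial: "0 \<le> (\<Sum>i=j..l. d i)" if "j \<le> l" "l < k" for l
    proof (rule ccontr)
      assume "\<not> ?thesis"
      moreover have "(\<Sum>i=j..k. d i) = (\<Sum>i=j..l. d i) + (\<Sum>i=Suc l..k. d i)"
        using that sum.ub_add_nat [of j l d "k - l"] by simp
      ultimately have "Suc l \<in> J"
        using j that by (auto simp: J_def)
      then have "Suc l \<le> j"
        using \<open>finite J\<close> by (simp add: j_def)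
      then show False
        using that by simp
    qed
    have "0 \<le> x k * (\<Sum>i=j..k. d i)"
      using j xpos [of k] k by simp
    also have "\<dots> \<le> (\<Sum>i=j..k. x i * d i)"
      using j decr less.prems by (intro Abel_sum_ge initial) auto
    \<comment> \<open>The tangent inequality x_i ln(y_i / x_i) \<le> y_i - x_i turns the comparison
      of products back into one of sums.\<close>
    also have "\<dots> \<le> (\<Sum>i=j..k. y i - x i)"
    proof (rule sum_mono)
      fix i assume "i \<in> {j..k}"
      then have "0 < x i"
        using j xpos by auto
      then have "d i \<le> (y i - x i) / x i"
        unfolding d_def using y_pos by (intro ln_diff_le)
      then show "x i * d i \<le> y i - x i"
        using \<open>0 < x i\<close> by (simp add: field_simps)
    qed
    finally have "(\<Sum>i=j..k. x i) \<le> (\<Sum>i=j..k. y i)"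
      by (simp add: sum_subtractf)
    moreover have "(\<Sum>i=1..j-1. x i) \<le> (\<Sum>i=1..j-1. y i)"
      unfolding y_def using j less.prems by (intro less.IH) auto
    moreover have "(\<Sum>i=1..k. f i) = (\<Sum>i=1..j-1. f i) + (\<Sum>i=j..k. f i)" for f :: "nat \<Rightarrow> real"
      using j sum.ub_add_nat [of 1 "j - 1" f "k - (j - 1)"] by simp
    ultimately show False
      using gt by (simp add: y_def)
  qed
qed

text \<open>By the previous lemma x is majorized by \<open>(1/s\<^sub>1, \<dots>, 1/s\<^sub>n, 1/(s\<^sub>1 \<cdots> s\<^sub>n))\<close>, and ln is concave.\<close>
lemma
  fixes x :: "nat \<Rightarrow> real"
  assumes pos: "\<And>i. 1 \<le> i \<Longrightarrow> i \<le> Suc n \<Longrightarrow> 0 < x i"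
    and decr: "\<And>i. 1 \<le> i \<Longrightarrow> i \<le> n \<Longrightarrow> x (Suc i) \<le> x i"
    and sum_1: "(\<Sum>i=1..Suc n. x i) = 1"
    and sum_prod: "\<And>k. 1 \<le> k \<Longrightarrow> k \<le> n \<Longrightarrow> (\<Sum>i=1..k. x i) + (\<Prod>i=1..k. x i) \<le> 1"
  shows prod_ge_sylvester: "1 / (\<Prod>i=1..n. real (sylvester i))\<^sup>2 \<le> (\<Prod>i=1..Suc n. x i)"
    and prod_eq_sylvesterD: "(\<Prod>i=1..Suc n. x i) = 1 / (\<Prod>i=1..n. real (sylvester i))\<^sup>2 \<Longrightarrow>
      1 \<le> i \<Longrightarrow> i \<le> Suc n \<Longrightarrow>
      x i = (if i \<le> n then 1 / real (sylvester i) else 1 / (\<Prod>i=1..n. real (sylvester i)))"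
proof -
  define P where "P = (\<Prod>i=1..n. real (sylvester i))"
  have P: "0 < P"
    unfolding P_def by (intro prod_pos) (simp add: sylvester_pos)
  define z where "z = (\<lambda>i. if i \<le> n then 1 / real (sylvester i) else 1 / P)"
  have z_pos: "0 < z i" for i
    using P by (simp add: z_def sylvester_pos)
  have z_sum: "(\<Sum>i=1..k. z i) = (\<Sum>i=1..k. 1 / real (sylvester i))" if "k \<le> n" for k
    using that by (intro sum.cong) (auto simp: z_def)
  \<comment> \<open>Concavity of ln enters through its tangents at x, with slopes 1/x_i. The partial
    sums of z - x are nonnegative by the preceding lemma, and the total on the left vanishes since z
    and x both sum to 1.\<close>
  have "- 1 / x (Suc n) * (\<Sum>i=1..Suc n. z i - x i) \<le> (\<Sum>i=1..Suc n. - 1 / x i * (z i - x i))"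
  proof (rule Abel_sum_ge)
    fix k assume k: "1 \<le> k" "k < Suc n"
    then show "- 1 / x (Suc k) \<le> - 1 / x k"
      using pos [of k] pos [of "Suc k"] decr [of k] by (simp add: field_simps)
    show "0 \<le> (\<Sum>i=1..k. z i - x i)"
      using sum_le_sum_inverse_sylvester [of n x k] assms k z_sum [of k]
      by (simp add: sum_subtractf)
  qed simp
  moreover have "(\<Sum>i=1..Suc n. z i) = 1"
  proof -
    have "(\<Sum>i=1..Suc n. z i) = (\<Sum>i=1..n. z i) + 1 / P"
      by (simp add: z_def)
    also have "(\<Sum>i=1..n. z i) = 1 - 1 / P"
      using z_sum [of n] sum_inverse_sylvester [of n] by (simp add: P_def)
    finally show ?thesis
      by simp
  qed
  ultimately have "(\<Sum>i=1..Suc n. - 1 / x i * (z i - x i)) \<ge> 0"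
    using sum_1 by (simp only: sum_subtractf) simp
  moreover have "(\<Sum>i=1..Suc n. - 1 / x i * (z i - x i)) = - (\<Sum>i=1..Suc n. z i / x i - 1)"
    unfolding sum_negf [symmetric]
  proof (rule sum.cong)
    fix i assume "i \<in> {1..Suc n}"
    then show "- 1 / x i * (z i - x i) = - (z i / x i - 1)"
      using pos [of i] by (simp add: field_simps)
  qed simp
  ultimately have sum_le: "(\<Sum>i=1..Suc n. z i / x i - 1) \<le> 0"
    by linarith
  have t_pos: "0 < z i / x i" if "i \<in> {1..Suc n}" for i
    using that pos z_pos by simp
  have prod_z: "(\<Prod>i=1..Suc n. z i) = 1 / P\<^sup>2"
  proof -
    have "(\<Prod>i=1..n. z i) = (\<Prod>i=1..n. 1 / real (sylvester i))"
      by (intro prod.cong) (auto simp: z_def)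
    also have "\<dots> = 1 / P"
      by (simp add: P_def prod_dividef)
    finally show ?thesis
      by (simp add: z_def power2_eq_square)
  qed
  have prod_x: "0 < (\<Prod>i=1..Suc n. x i)"
    using pos by (intro prod_pos) auto
  have prod_t: "(\<Prod>i=1..Suc n. z i / x i) = 1 / P\<^sup>2 / (\<Prod>i=1..Suc n. x i)"
    by (simp only: prod_dividef prod_z)
  have "(\<Prod>i=1..Suc n. z i / x i) \<le> 1"
    by (rule prod_le_1_of_sum_minus_1) (use t_pos sum_le in auto)
  then show "1 / (\<Prod>i=1..n. real (sylvester i))\<^sup>2 \<le> (\<Prod>i=1..Suc n. x i)"
    using prod_x by (simp only: prod_t P_def [symmetric] pos_divide_le_eq mult_1)
  assume "(\<Prod>i=1..Suc n. x i) = 1 / (\<Prod>i=1..n. real (sylvester i))\<^sup>2" and i: "1 \<le> i" "i \<le> Suc n"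
  then have eq: "(\<Prod>i=1..Suc n. z i / x i) = 1"
    using prod_x by (simp only: prod_t P_def [symmetric] divide_self_if) simp
  have "z i / x i = 1"
    by (rule prod_le_1_of_sum_minus_1(2) [OF _ t_pos sum_le eq]) (use i in auto)
  then have "x i = z i"
    using pos [OF i] by (simp add: field_simps)
  then show "x i = (if i \<le> n then 1 / real (sylvester i) else 1 / (\<Prod>i=1..n. real (sylvester i)))"
    by (simp add: z_def P_def)
qed

section \<open>Volume and centroid of affine images of the corner simplex\<close>

lemma borel_measurable_affine:
  fixes A :: "real^'n^'n"
  shows "(\<lambda>x. c + A *v x) \<in> borel_measurable borel"
  by (intro borel_measurable_continuous_onI continuous_intros)

lemma lborel_affine_map:
  fixes A :: "real^'n^'n"
  assumes "det A \<noteq> 0"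
  shows "lborel = density (distr lborel borel (\<lambda>x. c + A *v x)) (\<lambda>_. ennreal \<bar>det A\<bar>)"
proof -
  have "distr lborel borel (\<lambda>x. c + A *v x) = distr (distr lborel borel ((*v) A)) borel ((+) c)"
    using borel_measurable_affine [of 0 A] by (subst distr_distr) (auto simp: o_def)
  then have "density (distr lborel borel (\<lambda>x. c + A *v x)) (\<lambda>_. ennreal \<bar>det A\<bar>)
      = distr (density (distr lborel borel ((*v) A)) (\<lambda>_. ennreal \<bar>det A\<bar>)) borel ((+) c)"
    by (simp add: density_distr)
  also have "\<dots> = lborel"
    by (simp add: lborel_linear [OF assms, symmetric] lborel_distr_plus)
  finally show ?thesis ..
qed

lemma inj_affine_map:
  fixes A :: "real^'n^'n"
  assumes "det A \<noteq> 0"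
  shows "inj (\<lambda>x. c + A *v x)"
  using assms inj_matrix_vector_mult [of A] by (auto simp: inj_on_def invertible_det_nz)

lemma compact_affine_image:
  fixes A :: "real^'n^'n"
  assumes "compact K"
  shows "compact ((\<lambda>x. c + A *v x) ` K)"
  by (intro compact_continuous_image continuous_intros assms)

lemma integral_affine_image:
  fixes A :: "real^'n^'n" and g :: "real^'n \<Rightarrow> 'b::euclidean_space"
  assumes "det A \<noteq> 0" "compact K" "continuous_on UNIV g"
  shows "integral ((\<lambda>x. c + A *v x) ` K) g = \<bar>det A\<bar> *\<^sub>R integral K (\<lambda>x. g (c + A *v x))"
proof -
  let ?T = "\<lambda>x. c + A *v x"
  \<comment> \<open>The gauge integral, in which \<open>centroid\<close> is expressed, agrees with
    the Lebesgue integral for continuous functions on compact sets; the latter is what the change of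
    measure transforms.\<close>
  have lebesgue: "integral K f = (LINT x|lborel. indicator K x *\<^sub>R f x)"
    if "compact K" "continuous_on UNIV f" for K and f :: "real^'n \<Rightarrow> 'b"
    using that set_borel_integral_eq_integral(2) [of K f] borel_integrable_compact [of K f]
      continuous_on_subset [of UNIV f K]
    by (simp add: set_integrable_def set_lebesgue_integral_def)
  have compact: "compact (?T ` K)"
    by (rule compact_affine_image [OF assms(2)])
  have g: "g \<in> borel_measurable borel"
    using assms by (intro borel_measurable_continuous_onI)
  have ind: "(\<lambda>x. indicat_real (?T ` K) x *\<^sub>R g x) \<in> borel_measurable borel"
    using g compact by (intro borel_measurable_scaleR borel_measurable_indicator)
      (auto simp: borel_closed compact_imp_closed)
  have "integral (?T ` K) g = (LINT x|lborel. indicator (?T ` K) x *\<^sub>R g x)"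
    using compact assms by (intro lebesgue)
  also have "\<dots> = (LINT x|density (distr lborel borel ?T) (\<lambda>_. ennreal \<bar>det A\<bar>). indicator (?T ` K) x *\<^sub>R g x)"
    by (simp add: lborel_affine_map [OF assms(1), symmetric])
  also have "\<dots> = (LINT x|distr lborel borel ?T. \<bar>det A\<bar> *\<^sub>R indicator (?T ` K) x *\<^sub>R g x)"
    using ind by (intro integral_density) auto
  also have "\<dots> = (LINT x|lborel. \<bar>det A\<bar> *\<^sub>R indicator (?T ` K) (?T x) *\<^sub>R g (?T x))"
    using ind borel_measurable_affine by (intro integral_distr borel_measurable_scaleR [OF borel_measurable_const]) auto
  also have "\<dots> = \<bar>det A\<bar> *\<^sub>R (LINT x|lborel. indicator (?T ` K) (?T x) *\<^sub>R g (?T x))"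
    by (rule integral_scaleR_right)
  also have "\<dots> = \<bar>det A\<bar> *\<^sub>R (LINT x|lborel. indicator K x *\<^sub>R g (?T x))"
    by (simp add: indicator_def inj_image_mem_iff [OF inj_affine_map [OF assms(1)]])
  also have "\<dots> = \<bar>det A\<bar> *\<^sub>R integral K (\<lambda>x. g (?T x))"
    using assms by (subst lebesgue) (auto intro!: continuous_on_compose2 [of UNIV g] continuous_intros)
  finally show ?thesis .
qed

lemma vol_eq_integral: "compact K \<Longrightarrow> vol K = integral K (\<lambda>_. 1)"
  unfolding vol_def by (intro lmeasure_integral lmeasurable_compact)

lemma vol_affine_image:
  fixes A :: "real^'n^'n"
  assumes "det A \<noteq> 0" "compact K"
  shows "vol ((\<lambda>x. c + A *v x) ` K) = \<bar>det A\<bar> * vol K"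
  using integral_affine_image [OF assms, of "\<lambda>_. 1::real" c] assms
  by (simp add: vol_eq_integral compact_affine_image)

definition corner_simplex :: "(real^'n) set" where
  "corner_simplex = {x. (\<forall>i. 0 \<le> x $ i) \<and> (\<Sum>i\<in>UNIV. x $ i) \<le> 1}"

lemma corner_simplex_eq_hull: "(corner_simplex :: (real^'n) set) = convex hull (insert 0 Basis)"
proof -
  have "(\<Sum>b\<in>Basis. x \<bullet> b) = (\<Sum>i\<in>UNIV. x $ i)" for x :: "real^'n"
  proof -
    have "(\<Sum>b\<in>Basis. x \<bullet> b) = (\<Sum>b\<in>range (\<lambda>i. axis i 1). x \<bullet> b)"
      by (rule sum.cong) (auto simp: Basis_vec_def)
    also have "\<dots> = (\<Sum>i\<in>UNIV. x $ i)"
      by (subst sum.reindex) (auto simp: inj_on_def axis_eq_axis inner_axis)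
    finally show ?thesis .
  qed
  moreover have "(\<forall>b\<in>Basis. 0 \<le> x \<bullet> b) \<longleftrightarrow> (\<forall>i. 0 \<le> x $ i)" for x :: "real^'n"
    by (auto simp: Basis_vec_def inner_axis)
  ultimately show ?thesis
    by (simp add: corner_simplex_def std_simplex)
qed

lemma compact_corner_simplex: "compact (corner_simplex :: (real^'n) set)"
  unfolding corner_simplex_eq_hull by (intro finite_imp_compact_convex_hull) simp

lemma vol_corner_simplex: "vol (corner_simplex :: (real^'n) set) = 1 / fact CARD('n)"
proof -
  have "measure lebesgue (corner_simplex :: (real^'n) set) = measure lborel (corner_simplex :: (real^'n) set)"
    using borel_closed [OF compact_imp_closed [OF compact_corner_simplex]]
    by (intro measure_completion) simp
  then show ?thesis
    by (simp add: vol_def corner_simplex_eq_hull content_std_simplex)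
qed

text \<open>Exchanging the i-th vertex with the origin shows that all barycentric coordinates have the
  same mean.\<close>
lemma integral_corner_simplex_component:
  "integral corner_simplex (\<lambda>x::real^'n. x $ i) = vol (corner_simplex :: (real^'n) set) / (CARD('n) + 1)"
proof -
  let ?D = "corner_simplex :: (real^'n) set"
  let ?J = "integral ?D (\<lambda>x. 1 - (\<Sum>i\<in>UNIV. x $ i))"
  have exchange: "integral ?D (\<lambda>x. x $ i) = ?J" for i
  proof -
    \<comment> \<open>Row i of A is constantly -1 and the other rows are those of the identity. So
      \<open>T\<close> replaces the i-th coordinate by 1 minus the coordinate sum: it is the affine
      involution exchanging the origin with the i-th unit vector.\<close>
    define A :: "real^'n^'n" where
      "A = (\<chi> k j. (if k = j then 1 else 0) + axis i 1 $ k * (\<chi> j. - 1 - (if i = j then 1 else 0)) $ j)"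
    have "det A = 1 + (\<Sum>k\<in>UNIV. axis i 1 $ k * (- 1 - (if i = k then 1 else 0)))"
      unfolding A_def by (simp only: det_rank_one_update) simp
    also have "(\<Sum>k\<in>UNIV. axis i 1 $ k * (- 1 - (if i = k then 1 else 0))) = (\<Sum>k\<in>UNIV. if k = i then - 2 else (0::real))"
      by (intro sum.cong) (auto simp: axis_def)
    finally have det: "det A = - 1"
      by simp
    define T where "T = (\<lambda>x. axis i 1 + A *v x)"
    have T: "T x $ k = (if k = i then 1 - (\<Sum>i\<in>UNIV. x $ i) else x $ k)" for x k
    proof -
      have "(A *v x) $ k = (if k = i then - (\<Sum>i\<in>UNIV. x $ i) else x $ k)"
        by (auto simp: matrix_vector_mult_def A_def axis_def sum_negf [symmetric] if_distrib [of "\<lambda>a. a * _"]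
            intro!: sum.cong cong: if_cong)
      then show ?thesis
        by (simp add: T_def axis_def)
    qed
    have sum_T: "(\<Sum>k\<in>UNIV. T x $ k) = 1 - x $ i" for x
      by (simp add: T sum.remove [of UNIV i])
    have "T (T x) = x" for x
      by (simp add: vec_eq_iff T sum_T [unfolded T])
    moreover have "T x \<in> ?D" if "x \<in> ?D" for x
      using that sum_T [of x] by (auto simp: corner_simplex_def T)
    ultimately have "T ` ?D \<subseteq> ?D" "?D \<subseteq> T ` ?D"
      by (blast, metis (no_types, lifting) image_eqI subsetI)
    then have "T ` ?D = ?D"
      by (rule subset_antisym)
    moreover have "integral (T ` ?D) (\<lambda>x. x $ i) = \<bar>det A\<bar> *\<^sub>R integral ?D (\<lambda>x. T x $ i)"
      unfolding T_def using det
      by (intro integral_affine_image compact_corner_simplex continuous_intros) auto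
    ultimately show ?thesis
      by (simp add: det T)
  qed
  have int: "f integrable_on ?D" if "continuous_on UNIV f" for f :: "real^'n \<Rightarrow> real"
    using borel_integrable_compact [OF compact_corner_simplex continuous_on_subset [OF that]]
      set_borel_integral_eq_integral(1) [of ?D f] by (simp add: set_integrable_def)
  have "?J = integral ?D (\<lambda>x. 1) - integral ?D (\<lambda>x. \<Sum>i\<in>UNIV. x $ i)"
    by (intro Henstock_Kurzweil_Integration.integral_diff int continuous_intros)
  also have "integral ?D (\<lambda>x. \<Sum>i\<in>UNIV. x $ i) = (\<Sum>i\<in>UNIV. integral ?D (\<lambda>x. x $ i))"
    by (intro Henstock_Kurzweil_Integration.integral_sum int continuous_intros) auto
  also have "\<dots> = CARD('n) * ?J"
    by (simp add: exchange)
  finally show ?thesis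
    using vol_eq_integral [OF compact_corner_simplex, where 'a='n] exchange [of i]
    by (simp add: field_simps)
qed

lemma centroid_affine_corner_simplex:
  fixes A :: "real^'n^'n"
  assumes "det A \<noteq> 0"
  shows "centroid ((\<lambda>x. c + A *v x) ` corner_simplex) = c + (1 / (CARD('n) + 1)) *\<^sub>R (A *v 1)"
proof -
  let ?D = "corner_simplex :: (real^'n) set"
  have vol: "vol ?D > 0"
    by (simp add: vol_corner_simplex)
  have id: "(\<lambda>x. x) integrable_on ?D"
    using borel_integrable_compact [OF compact_corner_simplex continuous_on_id]
      set_borel_integral_eq_integral(1) [of ?D "\<lambda>x. x"] by (simp add: set_integrable_def)
  have "integral ?D (\<lambda>x. x) $ i = vol ?D / (CARD('n) + 1)" for i
    using integral_component_eq_cart [OF id, of i] integral_corner_simplex_component [of i] by simp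
  then have int: "integral ?D (\<lambda>x. x) = (vol ?D / (CARD('n) + 1)) *\<^sub>R 1"
    by (simp add: vec_eq_iff)
  have A_int: "((\<lambda>x. A *v x) has_integral A *v integral ?D (\<lambda>x. x)) ?D"
    using has_integral_linear [OF integrable_integral [OF id], of "(*v) A"]
    by (simp add: o_def linear_linear)
  have const: "((\<lambda>x. c) has_integral vol ?D *\<^sub>R c) ?D"
  proof -
    have "((\<lambda>_. 1) has_integral vol ?D) ?D"
      using vol_eq_integral [OF compact_corner_simplex, where 'a='n]
        integrable_integral [OF integrable_on_const [OF lmeasurable_compact [OF compact_corner_simplex]]]
      by simp
    from has_integral_linear [OF this, of "\<lambda>r. r *\<^sub>R c"] show ?thesis
      by (simp add: o_def bounded_linear_scaleR_left)
  qed
  have "integral ((\<lambda>x. c + A *v x) ` ?D) (\<lambda>x. x) = \<bar>det A\<bar> *\<^sub>R integral ?D (\<lambda>x. c + A *v x)"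
    using assms compact_corner_simplex by (intro integral_affine_image) (auto intro: continuous_intros)
  also have "integral ?D (\<lambda>x. c + A *v x) = vol ?D *\<^sub>R c + A *v integral ?D (\<lambda>x. x)"
    by (intro integral_unique has_integral_add const A_int)
  finally show ?thesis
    using vol assms
    by (simp add: centroid_def vol_affine_image compact_corner_simplex int matrix_vector_mult_scaleR
       scaleR_add_right)
qed

section \<open>Minkowski's theorem on linear forms\<close>

lemma countable_integral_points: "countable {x :: real^'n. integral_point x}"
proof -
  have "{x :: real^'n. integral_point x} \<subseteq> range (\<lambda>f::'n \<Rightarrow> int. \<chi> i. of_int (f i))"
  proof
    fix x :: "real^'n"
    assume "x \<in> {x. integral_point x}"
    then have "x = (\<chi> i. of_int \<lfloor>x $ i\<rfloor>)"
      by (simp add: vec_eq_iff integral_point_def)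
    then show "x \<in> range (\<lambda>f::'n \<Rightarrow> int. \<chi> i. of_int (f i))"
      by (rule range_eqI [where x = "\<lambda>i. \<lfloor>x $ i\<rfloor>"])
  qed
  then show ?thesis
    by (rule countable_subset) simp
qed

text \<open>B is cut along the integral translates of the half-open unit cube, and the pieces are
  shifted back into that cube. If no two points of B differed by an integral point, the shifted
  pieces would be disjoint and the volume of B at most 1.\<close>

lemma Blichfeldt:
  fixes B :: "(real^'n) set"
  assumes B: "B \<in> sets borel" and vol: "1 < emeasure lborel B"
  obtains x y where "x \<in> B" "y \<in> B" "x \<noteq> y" "integral_point (x - y)"
proof (rule ccontr)
  assume "\<not> thesis"
  with that have no: "x = y" if "x \<in> B" "y \<in> B" "integral_point (x - y)" for x y
    using \<open>x \<in> B\<close> \<open>y \<in> B\<close> \<open>integral_point (x - y)\<close> by blast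
  define I where "I = {k :: real^'n. integral_point k}"
  define Q :: "(real^'n) set" where "Q = {x. \<forall>i. 0 \<le> x $ i \<and> x $ i < 1}"
  have Q: "Q \<in> sets borel"
    unfolding Q_def by measurable
  have "emeasure lborel Q \<le> emeasure lborel (cbox 0 (\<chi> i. (1::real)) :: (real^'n) set)"
    by (rule emeasure_mono) (auto simp: Q_def mem_box_cart less_imp_le)
  also have "\<dots> = ennreal (measure lborel (cbox 0 (\<chi> i. (1::real)) :: (real^'n) set))"
    by (rule emeasure_eq_ennreal_measure) (simp add: emeasure_lborel_cbox_eq)
  also have "\<dots> = 1"
    by (subst content_cbox_cart) (auto simp: interval_ne_empty_cart)
  finally have Q_le: "emeasure lborel Q \<le> 1" .
  define Y where "Y = (\<lambda>k. {x \<in> B. x - k \<in> Q})"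
  define X where "X = (\<lambda>k. {x \<in> Q. k + x \<in> B})"
  have Y_sets: "Y k \<in> sets borel" and X_sets: "X k \<in> sets borel" for k
    unfolding X_def Y_def using B Q by measurable
  have XY: "emeasure lborel (Y k) = emeasure lborel (X k)" for k
  proof -
    have "emeasure lborel (Y k) = emeasure (distr lborel borel ((+) k)) (Y k)"
      by (simp add: lborel_distr_plus)
    also have "\<dots> = emeasure lborel ((+) k -` Y k)"
      using Y_sets by (subst emeasure_distr) auto
    also have "(+) k -` Y k = X k"
      by (auto simp: X_def Y_def)
    finally show ?thesis .
  qed
  have floor: "(\<chi> i. of_int \<lfloor>x $ i\<rfloor>) \<in> I" "x - (\<chi> i. of_int \<lfloor>x $ i\<rfloor>) \<in> Q" for x :: "real^'n"
    by (auto simp: I_def integral_point_def Q_def) linarith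
  have B_eq: "B = (\<Union>k\<in>I. Y k)"
    using floor by (auto simp: Y_def)
  have Y_disj: "disjoint_family_on Y I"
    unfolding disjoint_family_on_def
  proof (intro ballI impI, rule ccontr)
    fix k l assume kl: "k \<in> I" "l \<in> I" "k \<noteq> l" "Y k \<inter> Y l \<noteq> {}"
    then obtain x where x: "x - k \<in> Q" "x - l \<in> Q"
      by (auto simp: Y_def)
    have "k $ i = l $ i" for i
    proof -
      have "k $ i \<in> \<int>" "l $ i \<in> \<int>"
        using kl by (auto simp: I_def integral_point_def)
      then obtain a b where "k $ i = of_int a" "l $ i = of_int b"
        by (meson Ints_cases)
      moreover have "\<bar>k $ i - l $ i\<bar> < 1"
        using x by (auto simp: Q_def abs_if) (smt (verit))+
      ultimately show ?thesis
        by (simp flip: of_int_diff)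
    qed
    then show False
      using kl by (simp add: vec_eq_iff)
  qed
  have X_disj: "disjoint_family_on X I"
    unfolding disjoint_family_on_def
  proof (intro ballI impI, rule ccontr)
    fix k l assume kl: "k \<in> I" "l \<in> I" "k \<noteq> l" "X k \<inter> X l \<noteq> {}"
    then obtain x where x: "k + x \<in> B" "l + x \<in> B"
      by (auto simp: X_def)
    have "integral_point ((k + x) - (l + x))"
      using kl by (auto simp: I_def integral_point_def)
    from no [OF x this] kl show False
      by simp
  qed
  have I: "countable I"
    unfolding I_def by (rule countable_integral_points)
  have "emeasure lborel B = (\<integral>\<^sup>+k. emeasure lborel (Y k) \<partial>count_space I)"
    unfolding B_eq by (rule emeasure_UN_countable [OF _ I Y_disj]) (simp add: Y_sets)
  also have "\<dots> = (\<integral>\<^sup>+k. emeasure lborel (X k) \<partial>count_space I)"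
    by (simp add: XY)
  also have "\<dots> = emeasure lborel (\<Union>k\<in>I. X k)"
    by (rule emeasure_UN_countable [OF _ I X_disj, symmetric]) (simp add: X_sets)
  also have "\<dots> \<le> emeasure lborel Q"
    using Q by (intro emeasure_mono) (auto simp: X_def)
  finally show False
    using vol Q_le by (meson leD order_trans)
qed

text \<open>Blichfeldt's lemma is applied to the preimage under A of the box with sides (0, c_i),
  whose volume is \<Prod>c_i / |det A| > 1. Taking differences turns these one-sided bounds into |(A
  a)_i| < c_i.\<close>

lemma Minkowski_linear_forms:
  fixes A :: "real^'n^'n"
  assumes det: "det A \<noteq> 0" "\<bar>det A\<bar> < (\<Prod>i\<in>UNIV. c i)" and c: "\<And>i. 0 < c i"
  obtains a where "a \<noteq> 0" "integral_point a" "\<And>i. \<bar>(A *v a) $ i\<bar> < c i"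
proof -
  define C :: "(real^'n) set" where "C = box 0 (\<chi> i. c i)"
  have meas: "(*v) A \<in> lborel \<rightarrow>\<^sub>M borel"
    by (simp add: borel_measurable_continuous_onI linear_continuous_on linear_linear)
  have sets: "(*v) A -` C \<in> sets borel"
    using measurable_sets [OF meas, of C] by (simp add: C_def)
  have C_vol: "emeasure lborel C = ennreal (\<Prod>i\<in>UNIV. c i)"
  proof -
    have "emeasure lborel C = ennreal (measure lborel C)"
      by (rule emeasure_eq_ennreal_measure) (simp add: C_def emeasure_lborel_box_eq)
    also have "measure lborel C = measure lborel (cbox 0 (\<chi> i. c i) :: (real^'n) set)"
      by (simp add: C_def measure_lborel_box_eq measure_lborel_cbox_eq)
    also have "\<dots> = (\<Prod>i\<in>UNIV. c i)"
      using c by (subst content_cbox_cart) (auto simp: interval_ne_empty_cart less_imp_le)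
    finally show ?thesis .
  qed
  have "ennreal (\<Prod>i\<in>UNIV. c i) = ennreal \<bar>det A\<bar> * emeasure lborel ((*v) A -` C)"
  proof -
    have "emeasure lborel C = emeasure (density (distr lborel borel ((*v) A)) (\<lambda>_. ennreal \<bar>det A\<bar>)) C"
      by (simp add: lborel_linear [OF det(1), symmetric])
    also have "\<dots> = ennreal \<bar>det A\<bar> * emeasure lborel ((*v) A -` C)"
      using meas by (simp add: emeasure_density nn_integral_cmult emeasure_distr C_def)
    finally show ?thesis
      by (simp add: C_vol)
  qed
  moreover have "ennreal \<bar>det A\<bar> < ennreal (\<Prod>i\<in>UNIV. c i)"
    using det by (simp add: ennreal_less_iff)
  ultimately have "1 < emeasure lborel ((*v) A -` C)"
    by (metis leI mult.right_neutral mult_left_mono zero_le leD)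
  from Blichfeldt [OF sets this] obtain x y where
    xy: "A *v x \<in> C" "A *v y \<in> C" "x \<noteq> y" "integral_point (x - y)"
    by auto
  show thesis
  proof (rule that [of "x - y"])
    fix i
    have "0 < (A *v x) $ i" "(A *v x) $ i < c i" "0 < (A *v y) $ i" "(A *v y) $ i < c i"
      using xy by (simp_all add: C_def mem_box_cart)
    then show "\<bar>(A *v (x - y)) $ i\<bar> < c i"
      by (simp add: matrix_vector_mult_diff_distrib abs_if)
  qed (use xy in auto)
qed

text \<open>Minkowski's theorem is applied to the forms \<open>a\<^sub>i - \<beta>\<^sub>i t\<close> for \<open>i \<in> J\<close>, where t is the sum of
  the \<open>a\<^sub>i\<close> over J, and \<open>a\<^sub>i\<close> for \<open>i \<notin> J\<close>. Negating a if necessary makes t nonpositive.\<close>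
lemma barycentric_perturbation_exists:
  fixes \<beta> :: "'n::finite \<Rightarrow> real"
  assumes pos: "\<And>i. 0 < \<beta> i" and less: "(\<Sum>i\<in>J. \<beta> i) < 1"
    and prod: "1 - (\<Sum>i\<in>J. \<beta> i) < (\<Prod>i\<in>J. \<beta> i)"
  obtains a :: "real^'n" where "a \<noteq> 0" "integral_point a" "\<And>i. i \<notin> J \<Longrightarrow> a $ i = 0"
    "(\<Sum>i\<in>J. a $ i) \<le> 0" "\<And>i. i \<in> J \<Longrightarrow> \<bar>a $ i - \<beta> i * (\<Sum>i\<in>J. a $ i)\<bar> < \<beta> i"
proof -
  define u :: "real^'n" where "u = (\<chi> i. if i \<in> J then - \<beta> i else 0)"
  define w :: "real^'n" where "w = (\<chi> i. if i \<in> J then 1 else 0)"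
  define A :: "real^'n^'n" where "A = (\<chi> i j. (if i = j then 1 else 0) + u $ i * w $ j)"
  \<comment> \<open>Off J the form is the coordinate itself, and the bound 1 forces an integral
    coordinate to vanish without changing the product of the bounds.\<close>
  define c where "c = (\<lambda>i. if i \<in> J then \<beta> i else 1)"
  have "(\<Sum>i\<in>UNIV. u $ i * w $ i) = (\<Sum>i\<in>UNIV. if i \<in> J then - \<beta> i else 0)"
    by (intro sum.cong) (auto simp: u_def w_def)
  also have "\<dots> = - (\<Sum>i\<in>J. \<beta> i)"
    by (simp add: sum.If_cases sum_negf)
  finally have det: "det A = 1 - (\<Sum>i\<in>J. \<beta> i)"
    unfolding A_def by (simp add: det_rank_one_update)
  have c_prod: "(\<Prod>i\<in>UNIV. c i) = (\<Prod>i\<in>J. \<beta> i)"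
    by (simp add: c_def prod.If_cases)
  have c_pos: "0 < c i" for i
    using pos by (simp add: c_def)
  have "det A \<noteq> 0" "\<bar>det A\<bar> < (\<Prod>i\<in>UNIV. c i)"
    using less prod by (auto simp: det c_prod)
  from Minkowski_linear_forms [OF this c_pos] obtain a where
    a: "a \<noteq> 0" "integral_point a" "\<And>i. \<bar>(A *v a) $ i\<bar> < c i"
    by metis
  have Av: "(A *v x) $ i = x $ i + u $ i * (\<Sum>i\<in>J. x $ i)" for x i
  proof -
    have "(A *v x) $ i = (\<Sum>j\<in>UNIV. (if i = j then x $ j else 0) + u $ i * (if j \<in> J then x $ j else 0))"
      unfolding matrix_vector_mult_def A_def w_def by (auto simp: algebra_simps intro!: sum.cong)
    also have "\<dots> = x $ i + u $ i * (\<Sum>i\<in>J. x $ i)"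
      by (simp add: sum.distrib sum_distrib_left [symmetric] sum.If_cases)
    finally show ?thesis .
  qed
  have off: "a $ i = 0" if "i \<notin> J" for i
  proof -
    have "\<bar>a $ i\<bar> < 1"
      using a(3) [of i] that by (simp add: Av u_def c_def)
    moreover obtain k where "a $ i = of_int k"
      using a(2) by (auto simp: integral_point_def elim!: Ints_cases)
    ultimately show ?thesis
      by simp
  qed
  have on: "\<bar>a $ i - \<beta> i * (\<Sum>i\<in>J. a $ i)\<bar> < \<beta> i" if "i \<in> J" for i
    using a(3) [of i] that by (simp add: Av u_def c_def)
  show thesis
  proof (cases "(\<Sum>i\<in>J. a $ i) \<le> 0")
    case True
    show thesis
      by (rule that [of a]) (use True a off on in auto)
  next
    case False
    show thesis
      by (rule that [of "- a"])
        (use False a off on in \<open>auto simp: integral_point_def sum_negf abs_minus_commute\<close>)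
  qed
qed

section \<open>Simplices containing the origin\<close>

text \<open>Singling out \<open>v0\<close> leaves d vertices indexed by the coordinate type, so that
  they form a square matrix. Affine independence is encoded by the nonempty interior.\<close>

locale barycentric_simplex =
  fixes v :: "'n::finite \<Rightarrow> real^'n" and v0 :: "real^'n" and \<beta> :: "'n \<Rightarrow> real" and \<beta>0 :: real
  assumes pos: "\<And>i. 0 < \<beta> i" and pos0: "0 < \<beta>0"
    and sum_1: "\<beta>0 + (\<Sum>i\<in>UNIV. \<beta> i) = 1"
    and origin: "\<beta>0 *\<^sub>R v0 + (\<Sum>i\<in>UNIV. \<beta> i *\<^sub>R v i) = 0"
    and nonempty_interior: "interior (convex hull (insert v0 (range v))) \<noteq> {}"
begin

definition vertex_hull :: "(real^'n) set" where
  "vertex_hull = convex hull (insert v0 (range v))"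

definition vertex_matrix :: "real^'n^'n" where
  "vertex_matrix = (\<chi> i j. v j $ i)"

definition edge_matrix :: "real^'n^'n" where
  "edge_matrix = (\<chi> i j. v j $ i - v0 $ i)"

lemma vertex_matrix_mult: "vertex_matrix *v x = (\<Sum>j\<in>UNIV. x $ j *\<^sub>R v j)"
  by (simp add: vertex_matrix_def matrix_vector_mult_def vec_eq_iff mult.commute)

lemma edge_matrix_mult: "edge_matrix *v x = (\<Sum>j\<in>UNIV. x $ j *\<^sub>R (v j - v0))"
  by (simp add: edge_matrix_def matrix_vector_mult_def vec_eq_iff mult.commute)

lemma v0_eq: "v0 = - (\<Sum>i\<in>UNIV. (\<beta> i / \<beta>0) *\<^sub>R v i)"
proof -
  have "\<beta>0 *\<^sub>R v0 = - (\<Sum>i\<in>UNIV. \<beta> i *\<^sub>R v i)"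
    using origin by (simp add: eq_neg_iff_add_eq_0)
  then have "(1 / \<beta>0) *\<^sub>R \<beta>0 *\<^sub>R v0 = - (\<Sum>i\<in>UNIV. (1 / \<beta>0) *\<^sub>R \<beta> i *\<^sub>R v i)"
    by (simp add: scaleR_sum_right)
  then show ?thesis
    using pos0 by simp
qed

text \<open>A vector orthogonal to all \<open>v i\<close> is orthogonal to \<open>v0\<close> as
  well, which is a combination of them; the simplex would then lie in a hyperplane.\<close>

lemma det_vertex_matrix_nonzero: "det vertex_matrix \<noteq> 0"
proof
  assume "det vertex_matrix = 0"
  then have "\<not> invertible (transpose vertex_matrix)"
    by (simp add: invertible_det_nz det_transpose)
  then obtain y where y: "y \<noteq> 0" "transpose vertex_matrix *v y = 0"
    using matrix_left_invertible_ker [of "transpose vertex_matrix"] invertible_left_inverse by auto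
  have v: "y \<bullet> v j = 0" for j
    using y(2) by (simp add: vec_eq_iff matrix_vector_mult_def transpose_def vertex_matrix_def
        inner_vec_def mult.commute)
  have "y \<bullet> v0 = 0"
    by (subst v0_eq) (simp add: inner_sum_right v)
  with v have "convex hull (insert v0 (range v)) \<subseteq> {x. y \<bullet> x = 0}"
    by (intro hull_minimal convex_hyperplane) auto
  then have "interior (convex hull (insert v0 (range v))) \<subseteq> interior {x. y \<bullet> x = 0}"
    by (rule interior_mono)
  then show False
    using nonempty_interior interior_hyperplane [OF y(1)] by auto
qed

lemma vertex_matrix_mult_eq_0: "vertex_matrix *v x = 0 \<Longrightarrow> x = 0"
  using inj_matrix_vector_mult [of vertex_matrix] det_vertex_matrix_nonzero
  by (metis injD invertible_det_nz matrix_vector_mult_0_right)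

text \<open>Since v_j - v_0 = v_j + \<Sum> (\<beta>_k / \<beta>_0) v_k, passing from vertices to
  edges is a rank-one update, with determinant 1 + \<Sum> \<beta>_k / \<beta>_0 = 1 / \<beta>_0.
  This supplies the factor \<beta>_0 in the volume product.\<close>

lemma det_edge_matrix: "det edge_matrix = det vertex_matrix / \<beta>0"
proof -
  let ?N = "\<chi> i j. (if i = j then 1 else 0) + (\<chi> i. \<beta> i / \<beta>0) $ i * (\<chi> j. 1) $ j"
  have "edge_matrix = vertex_matrix ** ?N"
  proof -
    have "(vertex_matrix ** ?N) $ i $ j = v j $ i - v0 $ i" for i j
    proof -
      have "(vertex_matrix ** ?N) $ i $ j = (\<Sum>k\<in>UNIV. (if k = j then v k $ i else 0) + (\<beta> k / \<beta>0) * v k $ i)"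
        by (simp add: matrix_matrix_mult_def vertex_matrix_def) (auto intro!: sum.cong simp: algebra_simps)
      also have "\<dots> = v j $ i + (\<Sum>k\<in>UNIV. (\<beta> k / \<beta>0) * v k $ i)"
        by (simp add: sum.distrib)
      also have "(\<Sum>k\<in>UNIV. (\<beta> k / \<beta>0) * v k $ i) = - v0 $ i"
        by (subst v0_eq) simp
      finally show ?thesis
        by simp
    qed
    then show ?thesis
      by (simp add: edge_matrix_def vec_eq_iff)
  qed
  then have "det edge_matrix = det vertex_matrix * (1 + (\<Sum>i\<in>UNIV. \<beta> i / \<beta>0))"
    by (simp only: det_mul det_rank_one_update) simp
  also have "1 + (\<Sum>i\<in>UNIV. \<beta> i / \<beta>0) = 1 / \<beta>0"
    using sum_1 pos0 by (simp add: sum_divide_distrib [symmetric] field_simps)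
  finally show ?thesis
    by simp
qed

lemma det_edge_matrix_nonzero: "det edge_matrix \<noteq> 0"
  using det_vertex_matrix_nonzero pos0 by (simp add: det_edge_matrix)

lemma simplex_eq_image: "vertex_hull = (\<lambda>x. v0 + edge_matrix *v x) ` corner_simplex"
proof -
  have axis: "edge_matrix *v axis i 1 = v i - v0" for i
    by (simp add: edge_matrix_def vec_eq_iff matrix_vector_mult_basis column_def)
  have "(\<lambda>x. v0 + edge_matrix *v x) ` corner_simplex
      = (+) v0 ` (convex hull ((*v) edge_matrix ` insert 0 Basis))"
    by (simp add: corner_simplex_eq_hull image_image [symmetric] convex_hull_linear_image)
  also have "\<dots> = convex hull ((+) v0 ` (*v) edge_matrix ` insert 0 Basis)"
    by (rule convex_hull_translation [symmetric])
  also have "(+) v0 ` (*v) edge_matrix ` insert 0 Basis = insert v0 (range v)"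
    by (auto simp: Basis_vec_def axis image_iff)
  finally show ?thesis
    by (simp add: vertex_hull_def)
qed

lemma vol_simplex: "vol vertex_hull = \<bar>det vertex_matrix\<bar> / (\<beta>0 * fact CARD('n))"
  unfolding simplex_eq_image vol_affine_image [OF det_edge_matrix_nonzero compact_corner_simplex]
  using pos0 by (simp add: vol_corner_simplex det_edge_matrix abs_divide)

text \<open>In the coordinates \<open>x\<^sub>i = \<beta>\<^sub>i (1 - \<langle>v\<^sub>i, y\<rangle>)\<close> the polar body is the corner simplex.\<close>
lemma vol_polar_simplex: "vol (polar vertex_hull) = 1 / (\<bar>det vertex_matrix\<bar> * (\<Prod>i\<in>UNIV. \<beta> i) * fact CARD('n))"
proof -
  obtain B where B: "transpose vertex_matrix ** B = mat 1" "B ** transpose vertex_matrix = mat 1"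
    using det_vertex_matrix_nonzero invertible_det_nz [of "transpose vertex_matrix"]
    by (auto simp: invertible_def det_transpose)
  \<comment> \<open>Solving x_i = \<beta>_i (1 - v_i.y) for y gives y = B (1 - x/\<beta>), with
    constant part \<open>B *v 1\<close> and linear part N.\<close>
  define N :: "real^'n^'n" where "N = B ** (\<chi> i j. if i = j then - (1 / \<beta> i) else 0)"
  have "det (\<chi> i j. if i = j then - (1 / \<beta> i) else 0) = (\<Prod>i\<in>UNIV. - (1 / \<beta> i))"
    by (subst det_diagonal) auto
  then have det_N: "\<bar>det N\<bar> = \<bar>det B\<bar> / (\<Prod>i\<in>UNIV. \<beta> i)"
    using pos by (simp add: N_def det_mul abs_mult abs_prod prod_dividef abs_of_pos prod_pos)
  have det_B: "\<bar>det B\<bar> = 1 / \<bar>det vertex_matrix\<bar>"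
  proof -
    have "\<bar>det vertex_matrix\<bar> * \<bar>det B\<bar> = 1"
      using arg_cong [OF B(1), of det] by (simp add: det_mul det_transpose flip: abs_mult)
    then show ?thesis
      using det_vertex_matrix_nonzero by (simp add: field_simps)
  qed
  have N_mult: "N *v x = B *v (\<chi> i. - x $ i / \<beta> i)" for x
  proof -
    have "(\<chi> i j. if i = j then - (1 / \<beta> i) else 0) *v x = (\<chi> i. - x $ i / \<beta> i)"
      by (simp add: matrix_vector_mult_def vec_eq_iff if_distrib [of "\<lambda>a. a * _"] cong: if_cong)
    then show ?thesis
      by (simp add: N_def matrix_vector_mul_assoc [symmetric])
  qed
  have polar: "y \<in> polar vertex_hull \<longleftrightarrow> (\<forall>i. v i \<bullet> y \<le> 1) \<and> v0 \<bullet> y \<le> 1" for y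
  proof -
    have "vertex_hull \<subseteq> {x. x \<bullet> y \<le> 1}" if "(\<forall>i. v i \<bullet> y \<le> 1) \<and> v0 \<bullet> y \<le> 1"
      unfolding vertex_hull_def using that convex_halfspace_le [of y 1]
      by (intro hull_minimal) (auto simp: inner_commute)
    moreover have "v0 \<in> vertex_hull" "v i \<in> vertex_hull" for i
      by (auto simp: vertex_hull_def hull_inc)
    ultimately show ?thesis
      by (auto simp: polar_def)
  qed
  have tr: "(transpose vertex_matrix *v y) $ i = v i \<bullet> y" for y i
    by (simp add: matrix_vector_mult_def transpose_def vertex_matrix_def inner_vec_def)
  have corner: "(\<chi> i. \<beta> i * (1 - v i \<bullet> y)) \<in> corner_simplex \<longleftrightarrow> y \<in> polar vertex_hull" for y
  proof -
    \<comment> \<open>Pairing the relation \<open>origin\<close> with y shows that 1 - \<Sum> x_i =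
      \<beta>_0 (1 - v_0.y), so the last facet of the corner simplex corresponds to the vertex
      \<open>v0\<close>.\<close>
    have "\<beta>0 * (v0 \<bullet> y) + (\<Sum>i\<in>UNIV. \<beta> i * (v i \<bullet> y)) = 0"
      using arg_cong [OF origin, of "\<lambda>x. x \<bullet> y"] by (simp add: inner_add_left inner_sum_left)
    moreover have "(\<Sum>i\<in>UNIV. \<beta> i * (1 - v i \<bullet> y)) = 1 - \<beta>0 - (\<Sum>i\<in>UNIV. \<beta> i * (v i \<bullet> y))"
      using sum_1 by (simp add: right_diff_distrib sum_subtractf)
    moreover have "\<beta>0 * (v0 \<bullet> y) \<le> \<beta>0 \<longleftrightarrow> v0 \<bullet> y \<le> 1"
      using pos0 by simp
    ultimately have "(\<Sum>i\<in>UNIV. \<beta> i * (1 - v i \<bullet> y)) \<le> 1 \<longleftrightarrow> v0 \<bullet> y \<le> 1"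
      by linarith
    moreover have "0 \<le> \<beta> i * (1 - v i \<bullet> y) \<longleftrightarrow> v i \<bullet> y \<le> 1" for i
      using pos [of i] by (simp add: zero_le_mult_iff)
    ultimately show ?thesis
      by (simp add: polar corner_simplex_def)
  qed
  have "polar vertex_hull = (\<lambda>x. B *v 1 + N *v x) ` corner_simplex"
  proof (intro subset_antisym subsetI)
    fix y assume y: "y \<in> polar vertex_hull"
    have "B *v 1 + N *v (\<chi> i. \<beta> i * (1 - v i \<bullet> y)) = B *v (transpose vertex_matrix *v y)"
      unfolding N_mult matrix_vector_right_distrib [symmetric]
      using pos by (intro arg_cong [where f = "(*v) B"]) (simp add: vec_eq_iff tr less_imp_neq [symmetric] del: transpose_matrix_vector)
    also have "\<dots> = y"
      by (simp add: matrix_vector_mul_assoc B del: transpose_matrix_vector)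
    finally show "y \<in> (\<lambda>x. B *v 1 + N *v x) ` corner_simplex"
      using corner y by (metis (no_types, lifting) image_eqI)
  next
    fix y assume "y \<in> (\<lambda>x. B *v 1 + N *v x) ` corner_simplex"
    then obtain x where x: "x \<in> corner_simplex" "y = B *v 1 + N *v x"
      by blast
    then have "transpose vertex_matrix *v y = 1 + (\<chi> i. - x $ i / \<beta> i)"
      by (simp add: N_mult matrix_vector_right_distrib matrix_vector_mul_assoc B
          del: transpose_matrix_vector)
    then have "v i \<bullet> y = 1 - x $ i / \<beta> i" for i
      using tr [of y i] by simp
    then have "(\<chi> i. \<beta> i * (1 - v i \<bullet> y)) = x"
      using pos by (simp add: vec_eq_iff less_imp_neq [symmetric])
    with x corner [of y] show "y \<in> polar vertex_hull"
      by simp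
  qed
  moreover have "det N \<noteq> 0"
    using det_N det_B det_vertex_matrix_nonzero pos by (auto simp: less_imp_neq [symmetric])
  ultimately show ?thesis
    by (simp add: vol_affine_image compact_corner_simplex vol_corner_simplex det_N det_B)
qed

lemma vol_product: "(fact CARD('n))\<^sup>2 * vol vertex_hull * vol (polar vertex_hull) = 1 / (\<beta>0 * (\<Prod>i\<in>UNIV. \<beta> i))"
  using det_vertex_matrix_nonzero by (simp add: vol_simplex vol_polar_simplex power2_eq_square)

text \<open>The centroid is the mean of the vertices. Eliminating \<open>v0\<close> writes their sum
  as \<Sum> (1 - \<beta>_j / \<beta>_0) v_j, which vanishes only if every \<beta>_j equals
  \<beta>_0.\<close>

lemma centroid_eq_0_iff:
  "centroid vertex_hull = 0 \<longleftrightarrow> \<beta>0 = 1 / (CARD('n) + 1) \<and> (\<forall>i. \<beta> i = 1 / (CARD('n) + 1))"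
proof -
  let ?d = "real CARD('n)"
  have "centroid vertex_hull = v0 + (1 / (?d + 1)) *\<^sub>R (\<Sum>j\<in>UNIV. v j - v0)"
    unfolding simplex_eq_image centroid_affine_corner_simplex [OF det_edge_matrix_nonzero]
    by (simp add: edge_matrix_mult)
  also have "\<dots> = (1 / (?d + 1)) *\<^sub>R (v0 + (\<Sum>j\<in>UNIV. v j))"
  proof -
    have "v0 = (1 / (?d + 1)) *\<^sub>R ((?d + 1) *\<^sub>R v0)"
      by (simp add: add_pos_nonneg less_imp_neq [symmetric])
    then show ?thesis
      by (simp add: sum_subtractf scaleR_add_left scaleR_add_right scaleR_diff_right sum_constant_scaleR
          algebra_simps del: sum_constant)
  qed
  also have "v0 + (\<Sum>j\<in>UNIV. v j) = vertex_matrix *v (\<chi> j. 1 - \<beta> j / \<beta>0)"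
    by (subst v0_eq) (simp add: vertex_matrix_mult scaleR_diff_left sum_subtractf)
  finally have "centroid vertex_hull = 0 \<longleftrightarrow> vertex_matrix *v (\<chi> j. 1 - \<beta> j / \<beta>0) = 0"
    by (simp add: add_pos_nonneg less_imp_neq [symmetric])
  also have "\<dots> \<longleftrightarrow> (\<chi> j. 1 - \<beta> j / \<beta>0) = 0"
    using vertex_matrix_mult_eq_0 by fastforce
  also have "\<dots> \<longleftrightarrow> (\<forall>i. \<beta> i = \<beta>0)"
    using pos0 by (auto simp: vec_eq_iff field_simps)
  also have "\<dots> \<longleftrightarrow> \<beta>0 = 1 / (CARD('n) + 1) \<and> (\<forall>i. \<beta> i = 1 / (CARD('n) + 1))"
  proof
    assume eq: "\<forall>i. \<beta> i = \<beta>0"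
    then have "\<beta>0 * (?d + 1) = 1"
      using sum_1 by (simp add: algebra_simps)
    then have "\<beta>0 = 1 / (?d + 1)"
      by (simp add: field_simps)
    with eq show "\<beta>0 = 1 / (CARD('n) + 1) \<and> (\<forall>i. \<beta> i = 1 / (CARD('n) + 1))"
      by simp
  qed auto
  finally show ?thesis .
qed

lemma
  shows vol_product_ge: "real (CARD('n) + 1) ^ (CARD('n) + 1) \<le> 1 / (\<beta>0 * (\<Prod>i\<in>UNIV. \<beta> i))"
    and vol_product_eq_lower_iff: "real (CARD('n) + 1) ^ (CARD('n) + 1) = 1 / (\<beta>0 * (\<Prod>i\<in>UNIV. \<beta> i))
      \<longleftrightarrow> \<beta>0 = 1 / (CARD('n) + 1) \<and> (\<forall>i. \<beta> i = 1 / (CARD('n) + 1))"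
proof -
  define m where "m = real (CARD('n) + 1)"
  have m: "m > 0"
    by (simp add: m_def)
  \<comment> \<open>The option type indexes all d+1 vertices, with \<open>None\<close> standing for
    \<open>v0\<close>.\<close>
  define t where "t = case_option (m * \<beta>0) (\<lambda>i::'n. m * \<beta> i)"
  have sum_option: "(\<Sum>k\<in>UNIV. t k - 1) = (m * \<beta>0 - 1) + (\<Sum>i\<in>UNIV. m * \<beta> i - 1)"
    by (simp add: UNIV_option_conv t_def sum.reindex)
  have prod_option: "prod t UNIV = m * \<beta>0 * (\<Prod>i\<in>UNIV. m * \<beta> i)"
    by (simp add: UNIV_option_conv t_def prod.reindex)
  have "(\<Sum>i\<in>UNIV. m * \<beta> i - 1) = m * (\<Sum>i\<in>UNIV. \<beta> i) - (m - 1)"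
    by (simp add: sum_subtractf sum_distrib_left m_def)
  then have "(\<Sum>k\<in>UNIV. t k - 1) = m * (\<beta>0 + (\<Sum>i\<in>UNIV. \<beta> i)) - m"
    unfolding sum_option by (simp add: algebra_simps)
  then have le: "(\<Sum>k\<in>UNIV. t k - 1) \<le> 0"
    by (simp add: sum_1)
  have t_pos: "0 < t k" for k
    using m pos pos0 by (simp add: t_def split: option.split)
  have prod_t: "prod t UNIV = m ^ (CARD('n) + 1) * (\<beta>0 * (\<Prod>i\<in>UNIV. \<beta> i))"
    unfolding prod_option by (simp add: prod.distrib)
  have \<beta>_pos: "0 < \<beta>0 * (\<Prod>i\<in>UNIV. \<beta> i)"
    using pos pos0 by (simp add: prod_pos)
  show "real (CARD('n) + 1) ^ (CARD('n) + 1) \<le> 1 / (\<beta>0 * (\<Prod>i\<in>UNIV. \<beta> i))"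
    using prod_le_1_of_sum_minus_1(1) [OF _ t_pos le] prod_t \<beta>_pos
    by (simp only: m_def pos_le_divide_eq finite)
  have "real (CARD('n) + 1) ^ (CARD('n) + 1) = 1 / (\<beta>0 * (\<Prod>i\<in>UNIV. \<beta> i)) \<longleftrightarrow> prod t UNIV = 1"
    unfolding prod_t m_def using \<beta>_pos by (metis less_irrefl nonzero_eq_divide_eq)
  also have "\<dots> \<longleftrightarrow> (\<forall>k. t k = 1)"
    using prod_le_1_of_sum_minus_1(2) [OF _ t_pos le] by auto
  also have "\<dots> \<longleftrightarrow> \<beta>0 = 1 / m \<and> (\<forall>i. \<beta> i = 1 / m)"
    using m by (auto simp: t_def field_simps split: option.split)
  finally show "real (CARD('n) + 1) ^ (CARD('n) + 1) = 1 / (\<beta>0 * (\<Prod>i\<in>UNIV. \<beta> i))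
      \<longleftrightarrow> \<beta>0 = 1 / (CARD('n) + 1) \<and> (\<forall>i. \<beta> i = 1 / (CARD('n) + 1))"
    by (simp add: m_def)
qed

section \<open>Interior points and the inequality for subsets of the coordinates\<close>

lemma interior_simplexI:
  assumes "\<And>i. 0 < c i" "0 < c0" "c0 + (\<Sum>i\<in>UNIV. c i) = 1"
  shows "c0 *\<^sub>R v0 + (\<Sum>i\<in>UNIV. c i *\<^sub>R v i) \<in> interior vertex_hull"
proof -
  define U :: "(real^'n) set" where "U = {x. (\<forall>i. 0 < x $ i) \<and> (\<Sum>i\<in>UNIV. x $ i) < 1}"
  have "U = (\<Inter>i\<in>UNIV. {x. 0 < x $ i}) \<inter> {x. (\<Sum>i\<in>UNIV. x $ i) < 1}"
    by (auto simp: U_def)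
  moreover have "open {x::real^'n. 0 < x $ i}" "open {x::real^'n. (\<Sum>i\<in>UNIV. x $ i) < 1}" for i
    by (intro open_Collect_less continuous_intros)+
  ultimately have "open U"
    by (simp add: open_Int open_INT)
  moreover have "surj ((*v) edge_matrix)"
    using det_edge_matrix_nonzero
    by (simp add: invertible_det_nz [symmetric] invertible_right_inverse matrix_right_invertible_surjective)
  ultimately have "open ((*v) edge_matrix ` U)"
    by (intro open_surjective_linear_image) auto
  then have "open ((\<lambda>x. v0 + edge_matrix *v x) ` U)"
    using open_translation [of "(*v) edge_matrix ` U" v0] by (simp add: image_image)
  moreover have "(\<lambda>x. v0 + edge_matrix *v x) ` U \<subseteq> vertex_hull"
    unfolding simplex_eq_image by (intro image_mono) (auto simp: U_def corner_simplex_def less_imp_le)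
  moreover have "c0 *\<^sub>R v0 + (\<Sum>i\<in>UNIV. c i *\<^sub>R v i) = v0 + edge_matrix *v (\<chi> i. c i)"
  proof -
    have "(\<Sum>i\<in>UNIV. c i *\<^sub>R (v i - v0)) = (\<Sum>i\<in>UNIV. c i *\<^sub>R v i) - (\<Sum>i\<in>UNIV. c i) *\<^sub>R v0"
      by (simp add: scaleR_diff_right sum_subtractf scaleR_sum_left)
    moreover have "c0 *\<^sub>R v0 = v0 - (\<Sum>i\<in>UNIV. c i) *\<^sub>R v0"
      using assms(3) by (metis add_diff_cancel_right' scaleR_diff_left scaleR_one)
    ultimately show ?thesis
      by (simp add: edge_matrix_mult)
  qed
  moreover have "(\<chi> i. c i) \<in> U"
    using assms by (simp add: U_def)
  ultimately show ?thesis
    by (metis (no_types, lifting) image_eqI interior_maximal subsetD)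
qed

text \<open>If the inequality failed, perturbing the barycentric coordinates of the origin would produce a
  second interior integral point.\<close>
lemma product_sum_le:
  assumes integral: "\<And>i. integral_point (v i)"
    and unique: "\<And>x. x \<in> interior vertex_hull \<Longrightarrow> integral_point x \<Longrightarrow> x = 0"
  shows "(\<Sum>i\<in>J. \<beta> i) + (\<Prod>i\<in>J. \<beta> i) \<le> 1"
proof (rule ccontr)
  assume "\<not> ?thesis"
  then have prod: "1 - (\<Sum>i\<in>J. \<beta> i) < (\<Prod>i\<in>J. \<beta> i)"
    by simp
  have "(\<Sum>i\<in>J. \<beta> i) \<le> (\<Sum>i\<in>UNIV. \<beta> i)"
    using pos by (intro sum_mono2) (auto simp: less_imp_le)
  then have less: "(\<Sum>i\<in>J. \<beta> i) < 1"
    using pos0 sum_1 by linarith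
  from barycentric_perturbation_exists [OF pos less prod]
  obtain a :: "real^'n" where a: "a \<noteq> 0" "integral_point a" "\<And>i. i \<notin> J \<Longrightarrow> a $ i = 0"
    "(\<Sum>i\<in>J. a $ i) \<le> 0" "\<And>i. i \<in> J \<Longrightarrow> \<bar>a $ i - \<beta> i * (\<Sum>i\<in>J. a $ i)\<bar> < \<beta> i"
    by metis
  define t where "t = (\<Sum>i\<in>J. a $ i)"
  have t: "t = (\<Sum>i\<in>UNIV. a $ i)"
    unfolding t_def using a(3) by (intro sum.mono_neutral_left) auto
  \<comment> \<open>Barycentric coordinates of the integral point \<Sum> a_i v_i: the scaled origin
    (1 - t) \<beta> contributes nothing to the point and brings the total weight (1 - t) + t to
    1.\<close>
  define c where "c = (\<lambda>i. (1 - t) * \<beta> i + a $ i)"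
  have "0 < c i" for i
  proof (cases "i \<in> J")
    case True
    then show ?thesis
      using a(5) [of i] by (simp add: c_def t_def algebra_simps abs_if split: if_splits)
  next
    case False
    then show ?thesis
      using a(3,4) pos by (simp add: c_def t_def)
  qed
  moreover have "0 < (1 - t) * \<beta>0"
    using a(4) pos0 by (simp add: t_def)
  moreover have "(1 - t) * \<beta>0 + (\<Sum>i\<in>UNIV. c i) = 1"
  proof -
    have "(\<Sum>i\<in>UNIV. c i) = (1 - t) * (\<Sum>i\<in>UNIV. \<beta> i) + t"
      by (simp add: c_def sum.distrib sum_distrib_left [symmetric] t [symmetric])
    then have "(1 - t) * \<beta>0 + (\<Sum>i\<in>UNIV. c i) = (1 - t) * (\<beta>0 + (\<Sum>i\<in>UNIV. \<beta> i)) + t"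
      by (simp add: distrib_left)
    then show ?thesis
      by (simp add: sum_1)
  qed
  ultimately have "((1 - t) * \<beta>0) *\<^sub>R v0 + (\<Sum>i\<in>UNIV. c i *\<^sub>R v i) \<in> interior vertex_hull"
    by (rule interior_simplexI)
  also have "((1 - t) * \<beta>0) *\<^sub>R v0 + (\<Sum>i\<in>UNIV. c i *\<^sub>R v i)
      = (1 - t) *\<^sub>R (\<beta>0 *\<^sub>R v0 + (\<Sum>i\<in>UNIV. \<beta> i *\<^sub>R v i)) + vertex_matrix *v a"
    by (simp add: c_def scaleR_add_left sum.distrib scaleR_add_right scaleR_sum_right vertex_matrix_mult)
  also have "\<dots> = vertex_matrix *v a"
    by (simp add: origin)
  finally have "vertex_matrix *v a \<in> interior vertex_hull" .
  moreover have "integral_point (vertex_matrix *v a)"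
    using integral a(2) by (auto simp: integral_point_def vertex_matrix_mult intro!: Ints_sum Ints_mult)
  ultimately have "vertex_matrix *v a = 0"
    by (rule unique)
  then show False
    using vertex_matrix_mult_eq_0 a(1) by blast
qed

end

section \<open>The equality case of the upper bound\<close>

lemma integral_point_add: "integral_point x \<Longrightarrow> integral_point y \<Longrightarrow> integral_point (x + y)"
  by (simp add: integral_point_def)

lemma integral_point_diff: "integral_point x \<Longrightarrow> integral_point y \<Longrightarrow> integral_point (x - y)"
  by (simp add: integral_point_def)

lemma integral_point_matrix_mult:
  assumes "\<And>i j. A $ i $ j \<in> \<int>" "integral_point x"
  shows "integral_point (A *v x)"
  using assms by (auto simp: integral_point_def matrix_vector_mult_def intro!: Ints_sum Ints_mult)

lemma convex_hull_affine_image: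
  fixes A :: "real^'n^'n"
  shows "(\<lambda>x. A *v x + b) ` (convex hull V) = convex hull ((\<lambda>x. A *v x + b) ` V)"
proof -
  have "(\<lambda>x. A *v x + b) ` W = (+) b ` (*v) A ` W" for W
    by (simp add: image_image add.commute)
  then show ?thesis
    by (simp add: convex_hull_translation convex_hull_linear_image)
qed

context barycentric_simplex
begin

text \<open>The shape of the extremal coordinates: unit fractions 1/p_i completed by the reciprocal
  of the product of the p_i. The Sylvester numbers are substituted for p in the final
  theorem.\<close>

context
  fixes p :: "'n \<Rightarrow> nat"
  assumes p_pos: "\<And>i. 0 < p i"
    and \<beta>_p: "\<And>i. \<beta> i = 1 / real (p i)" and \<beta>0_p: "\<beta>0 = 1 / (\<Prod>i\<in>UNIV. real (p i))"
    and integral: "\<And>i. integral_point (v i)" "integral_point v0"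
begin

text \<open>Multiplying the relations \<open>sum_1\<close> and \<open>origin\<close> by the product P of the \<open>p\<^sub>i\<close> gives
  \<open>v\<^sub>i - v\<^sub>0 = P v\<^sub>i + \<Sum>\<^bsub>j \<noteq> i\<^esub> (P / p\<^sub>j) (v\<^sub>j - v\<^sub>i)\<close>, where all coefficients are divisible by \<open>p\<^sub>i\<close>.\<close>
lemma edge_divisible: "(v i $ k - v0 $ k) / real (p i) \<in> \<int>"
proof -
  define P where "P = (\<Prod>j\<in>UNIV. real (p j))"
  have P: "P > 0"
    unfolding P_def using p_pos by (intro prod_pos) auto
  have "(P / real (p j)) / real (p i) \<in> \<int>" if "j \<noteq> i" for j
  proof -
    have "P = real (p i) * (real (p j) * (\<Prod>l\<in>UNIV - {i} - {j}. real (p l)))"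
      unfolding P_def using that by (simp add: prod.remove [of UNIV i] prod.remove [of "UNIV - {i}" j])
    then have "(P / real (p j)) / real (p i) = real (\<Prod>l\<in>UNIV - {i} - {j}. p l)"
      using p_pos [of i] p_pos [of j] by simp
    then show ?thesis
      by (metis Ints_of_nat)
  qed
  moreover have "P / real (p i) \<in> \<int>"
  proof -
    have "P / real (p i) = real (\<Prod>l\<in>UNIV - {i}. p l)"
      unfolding P_def using p_pos [of i] by (simp add: prod.remove [of UNIV i])
    then show ?thesis
      by (metis Ints_of_nat)
  qed
  moreover have int: "v j $ k \<in> \<int>" for j
    using integral by (simp add: integral_point_def)
  ultimately have "P / real (p i) * v i $ k
      + (\<Sum>j\<in>UNIV - {i}. (P / real (p j)) / real (p i) * (v j $ k - v i $ k)) \<in> \<int>"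
    by (intro Ints_add Ints_sum Ints_mult Ints_diff) auto
  moreover have "v i $ k - v0 $ k = P * v i $ k + (\<Sum>j\<in>UNIV - {i}. P / real (p j) * (v j $ k - v i $ k))"
  proof -
    have "(\<Sum>j\<in>UNIV. P / real (p j)) = P * (\<Sum>j\<in>UNIV. \<beta> j)"
      by (simp add: \<beta>_p sum_distrib_left)
    also have "\<dots> = P * (1 - \<beta>0)"
      using sum_1 by (metis add_diff_cancel_left')
    also have "\<dots> = P - 1"
      using P by (simp add: \<beta>0_p P_def [symmetric] field_simps)
    finally have one: "(\<Sum>j\<in>UNIV. P / real (p j)) = P - 1" .
    have "\<beta>0 * v0 $ k + (\<Sum>j\<in>UNIV. \<beta> j * v j $ k) = 0"
      using arg_cong [OF origin, of "\<lambda>x. x $ k"] by simp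
    then have "P * (\<beta>0 * v0 $ k) + P * (\<Sum>j\<in>UNIV. \<beta> j * v j $ k) = 0"
      by (metis distrib_left mult_zero_right)
    moreover have "P * (\<beta>0 * v0 $ k) = v0 $ k"
      using P by (simp add: \<beta>0_p P_def [symmetric])
    moreover have "P * (\<Sum>j\<in>UNIV. \<beta> j * v j $ k) = (\<Sum>j\<in>UNIV. P / real (p j) * v j $ k)"
      by (simp add: \<beta>_p sum_distrib_left)
    ultimately have "v0 $ k = - (\<Sum>j\<in>UNIV. P / real (p j) * v j $ k)"
      by linarith
    moreover have "(\<Sum>j\<in>UNIV - {i}. P / real (p j) * (v j $ k - v i $ k))
        = (\<Sum>j\<in>UNIV. P / real (p j) * (v j $ k - v i $ k))"
      by (intro sum.mono_neutral_left) auto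
    moreover have "(\<Sum>j\<in>UNIV. P / real (p j) * (v j $ k - v i $ k))
        = (\<Sum>j\<in>UNIV. P / real (p j) * v j $ k) - (P - 1) * v i $ k"
      unfolding one [symmetric] sum_distrib_right sum_subtractf [symmetric] by (simp add: right_diff_distrib)
    ultimately show ?thesis
      by (simp add: algebra_simps)
  qed
  ultimately show ?thesis
    by (simp add: add_divide_distrib sum_divide_distrib)
qed

text \<open>The affine map with \<open>v\<^sub>0 \<mapsto> 0\<close> and \<open>v\<^sub>i \<mapsto> p\<^sub>i e\<^sub>i\<close> sends the integral points to a superlattice of
  the integral points. A proper superlattice would contain a non-integral point of \<open>(0,1]\<^sup>d\<close>, which
  is interior to the image simplex and different from the image \<open>(1,\<dots>,1)\<close> of the origin.\<close>
lemma unimod_equiv_axis_simplex: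
  assumes unique: "\<And>x. x \<in> interior vertex_hull \<Longrightarrow> integral_point x \<Longrightarrow> x = 0"
  shows "unimod_equiv vertex_hull (convex hull (insert 0 (range (\<lambda>i. real (p i) *\<^sub>R axis i 1))))"
proof -
  \<comment> \<open>Its columns are the edges divided by p_j, integral by
    \<open>edge_divisible\<close>. Thus g takes p_j e_j to \<open>v j\<close> and 0 to
    \<open>v0\<close>, and f is its inverse.\<close>
  define G :: "real^'n^'n" where "G = (\<chi> i j. (v j $ i - v0 $ i) / real (p j))"
  define g where "g = (\<lambda>y. v0 + G *v y)"
  have G_mult: "G *v y = edge_matrix *v (\<chi> j. y $ j / real (p j))" for y
    by (simp add: G_def edge_matrix_def matrix_vector_mult_def vec_eq_iff)
  have "y = 0" if "G *v y = 0" for y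
  proof -
    have "0 + edge_matrix *v (\<chi> j. y $ j / real (p j)) = 0 + edge_matrix *v 0"
      using that by (simp add: G_mult)
    then have "(\<chi> j. y $ j / real (p j)) = 0"
      by (rule injD [OF inj_affine_map [OF det_edge_matrix_nonzero]])
    then show ?thesis
      using p_pos by (simp add: vec_eq_iff less_imp_neq [symmetric])
  qed
  then have "invertible G"
    using matrix_left_invertible_ker [of G] invertible_left_inverse by blast
  then obtain C where C: "G ** C = mat 1" "C ** G = mat 1"
    by (auto simp: invertible_def)
  define f where "f = (\<lambda>x. C *v x + (- (C *v v0)))"
  have fg: "f (g y) = y" for y
    by (simp add: f_def g_def matrix_vector_right_distrib matrix_vector_mul_assoc C)
  have gf: "g (f x) = x" for x
    by (simp add: f_def g_def matrix_vector_mult_diff_distrib matrix_vector_mul_assoc C)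
  have "bij f"
    by (rule o_bij [of g]) (auto simp: fg gf fun_eq_iff)
  have g_integral: "integral_point (g y)" if "integral_point y" for y
    unfolding g_def using that integral edge_divisible
    by (intro integral_point_add integral_point_matrix_mult) (auto simp: G_def)
  \<comment> \<open>The weights y_i / p_i are positive and sum to at most \<Sum>\<beta>_i = 1 -
    \<beta>_0, which leaves a positive weight for \<open>v0\<close>.\<close>
  have g_interior: "g y \<in> interior vertex_hull" if "\<And>i. 0 < y $ i" "\<And>i. y $ i \<le> 1" for y
  proof -
    have "(\<Sum>i\<in>UNIV. y $ i / real (p i)) \<le> (\<Sum>i\<in>UNIV. \<beta> i)"
      using that p_pos by (intro sum_mono) (simp add: \<beta>_p divide_right_mono)
    then have "(1 - (\<Sum>i\<in>UNIV. y $ i / real (p i))) *\<^sub>R v0 + (\<Sum>i\<in>UNIV. (y $ i / real (p i)) *\<^sub>R v i)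
        \<in> interior vertex_hull"
      using sum_1 pos0 that p_pos by (intro interior_simplexI) auto
    also have "(1 - (\<Sum>i\<in>UNIV. y $ i / real (p i))) *\<^sub>R v0 + (\<Sum>i\<in>UNIV. (y $ i / real (p i)) *\<^sub>R v i) = g y"
      by (simp add: g_def G_mult edge_matrix_mult scaleR_diff_left scaleR_diff_right sum_subtractf scaleR_sum_left)
    finally show ?thesis .
  qed
  have "integral_point 1"
    by (simp add: integral_point_def)
  then have g1: "g 1 = 0"
    by (intro unique g_interior g_integral) auto
  have f_integral: "integral_point (f x)" if x: "integral_point x" for x
  proof -
    \<comment> \<open>Ceiling minus 1 rather than floor: an integral coordinate of
      \<open>f x\<close> leaves remainder 1, not 0, which would be on the boundary of the image
      simplex.\<close>
    define c :: "real^'n" where "c = (\<chi> i. of_int (\<lceil>f x $ i\<rceil> - 1))"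
    have c: "integral_point c"
      by (simp add: c_def integral_point_def)
    have "g (f x - c) = x - G *v c"
      using gf [of x] by (simp add: g_def matrix_vector_mult_diff_distrib)
    moreover have "integral_point (G *v c)"
      using c edge_divisible by (intro integral_point_matrix_mult) (auto simp: G_def)
    ultimately have "integral_point (g (f x - c))"
      using x by (simp add: integral_point_diff)
    moreover have "g (f x - c) \<in> interior vertex_hull"
      by (rule g_interior) (simp_all add: c_def, linarith+)
    ultimately have "g (f x - c) = g 1"
      unfolding g1 by (intro unique)
    then have "f x - c = 1"
      by (metis fg)
    then have "f x = c + 1"
      by (simp add: algebra_simps)
    then show ?thesis
      using c by (simp add: integral_point_add \<open>integral_point 1\<close>)
  qed
  have lattice: "f ` {x. integral_point x} = {x. integral_point x}"
    using f_integral g_integral fg by (force simp: image_iff)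
  have "f v0 = 0"
    using fg [of 0] by (simp add: g_def)
  moreover have "f (v i) = real (p i) *\<^sub>R axis i 1" for i
  proof -
    have "g (real (p i) *\<^sub>R axis i 1) = v i"
      using p_pos [of i]
      by (simp add: g_def G_def vec_eq_iff matrix_vector_mult_scaleR matrix_vector_mult_basis column_def)
    then show ?thesis
      by (metis fg)
  qed
  ultimately have "f ` vertex_hull = convex hull (insert 0 (range (\<lambda>i. real (p i) *\<^sub>R axis i 1)))"
    unfolding vertex_hull_def
    using convex_hull_affine_image [of C "- (C *v v0)" "insert v0 (range v)", folded f_def]
    by (simp add: image_image)
  then show ?thesis
    unfolding unimod_equiv_def using \<open>bij f\<close> lattice f_def by blast
qed

end

end

section \<open>The volume product of simplices equivalent to the Sylvester simplex\<close>

lemma T_simplex_eq: "T_simplex \<sigma> = convex hull (insert 0 (range (\<lambda>i. real (sylvester (\<sigma> i)) *\<^sub>R axis i 1)))"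
proof -
  have "{real (sylvester (\<sigma> i)) *\<^sub>R axis i 1 | i. True} = range (\<lambda>i. real (sylvester (\<sigma> i)) *\<^sub>R axis i (1::real))"
    by auto
  then show ?thesis
    by (simp add: T_simplex_def)
qed

lemma
  assumes "bij_betw \<sigma> (UNIV :: 'n::finite set) {1..CARD('n)}"
  shows prod_sylvester_reindex:
      "(\<Prod>i\<in>UNIV. real (sylvester (\<sigma> i))) = (\<Prod>k=1..CARD('n). real (sylvester k))"
    and sum_sylvester_reindex:
      "(\<Sum>i\<in>UNIV. 1 / real (sylvester (\<sigma> i))) = 1 - 1 / (\<Prod>i\<in>UNIV. real (sylvester (\<sigma> i)))"
proof -
  show eq: "(\<Prod>i\<in>UNIV. real (sylvester (\<sigma> i))) = (\<Prod>k=1..CARD('n). real (sylvester k))"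
    using prod.reindex_bij_betw [OF assms, of "\<lambda>k. real (sylvester k)"] by simp
  show "(\<Sum>i\<in>UNIV. 1 / real (sylvester (\<sigma> i))) = 1 - 1 / (\<Prod>i\<in>UNIV. real (sylvester (\<sigma> i)))"
    unfolding eq using sum.reindex_bij_betw [OF assms, of "\<lambda>k. 1 / real (sylvester k)"]
      sum_inverse_sylvester [of "CARD('n)"] by simp
qed

text \<open>An interior integral point has all coordinates at least 1. The all-ones point has \<Sum>
  1/s_i = 1 - 1/P, and raising coordinate k by one costs another 1/s_k \<ge> 1/P, so the facet
  condition \<Sum> b_i / s_i < 1 would fail.\<close>

lemma integral_point_interior_T_simplex:
  fixes \<sigma> :: "'n::finite \<Rightarrow> nat" and b :: "real^'n"
  assumes \<sigma>: "bij_betw \<sigma> UNIV {1..CARD('n)}"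
    and b: "b \<in> interior (T_simplex \<sigma>)" "integral_point b"
  shows "b = 1"
proof -
  define s where "s = (\<lambda>i. real (sylvester (\<sigma> i)))"
  define P where "P = (\<Prod>i\<in>UNIV. s i)"
  have s_ge: "1 \<le> s i" for i
    using sylvester_pos [of "\<sigma> i"] by (simp add: s_def)
  then have s_pos: "0 < s i" for i
    by (meson less_le_trans zero_less_one)
  have b_ge: "1 \<le> b $ i" for i
  proof -
    have "T_simplex \<sigma> \<subseteq> {x. axis i 1 \<bullet> x \<ge> 0}"
      unfolding T_simplex_eq by (intro hull_minimal convex_halfspace_ge) (auto simp: inner_axis_axis)
    then have "b \<in> interior {x. axis i 1 \<bullet> x \<ge> 0}"
      using b interior_mono by blast
    then have "0 < b $ i"
      by (simp add: interior_halfspace_ge axis_eq_0_iff inner_axis')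
    moreover have "b $ i \<in> \<int>"
      using b by (simp add: integral_point_def)
    ultimately show ?thesis
      by (auto elim!: Ints_cases)
  qed
  define a :: "real^'n" where "a = (\<chi> i. 1 / s i)"
  have "a \<noteq> 0"
    using s_pos by (auto simp: a_def vec_eq_iff less_imp_neq [symmetric])
  have "a \<bullet> (s i *\<^sub>R axis i 1) = 1" for i
    using s_pos [of i] by (simp add: a_def inner_axis)
  then have "T_simplex \<sigma> \<subseteq> {x. a \<bullet> x \<le> 1}"
    unfolding T_simplex_eq by (intro hull_minimal convex_halfspace_le) (auto simp: s_def)
  then have "b \<in> interior {x. a \<bullet> x \<le> 1}"
    using b interior_mono by blast
  then have less: "(\<Sum>i\<in>UNIV. b $ i / s i) < 1"
    by (simp add: interior_halfspace_le [OF \<open>a \<noteq> 0\<close>]) (simp add: a_def inner_vec_def)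
  have "b $ k = 1" for k
  proof (rule ccontr)
    assume "b $ k \<noteq> 1"
    moreover have "b $ k \<in> \<int>"
      using b by (simp add: integral_point_def)
    ultimately have "2 \<le> b $ k"
      using b_ge [of k] by (auto elim!: Ints_cases)
    then have "(\<Sum>i\<in>UNIV. 1 / s i) + 1 / s k \<le> (\<Sum>i\<in>UNIV. b $ i / s i)"
    proof -
      have "(\<Sum>i\<in>UNIV - {k}. 1 / s i) \<le> (\<Sum>i\<in>UNIV - {k}. b $ i / s i)"
        using b_ge s_pos by (intro sum_mono divide_right_mono) (auto simp: less_imp_le)
      moreover have "2 / s k \<le> b $ k / s k"
        using \<open>2 \<le> b $ k\<close> s_pos [of k] by (intro divide_right_mono) auto
      ultimately show ?thesis
        by (simp add: sum.remove [of UNIV k])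
    qed
    moreover have "(\<Sum>i\<in>UNIV. 1 / s i) = 1 - 1 / P"
      unfolding s_def P_def by (rule sum_sylvester_reindex [OF \<sigma>])
    moreover have "1 / P \<le> 1 / s k"
    proof -
      have "1 \<le> (\<Prod>i\<in>UNIV - {k}. s i)"
        by (intro prod_ge_1 s_ge)
      then have "s k * 1 \<le> s k * (\<Prod>i\<in>UNIV - {k}. s i)"
        using s_pos [of k] by (intro mult_left_mono) auto
      then have "s k \<le> P"
        by (simp add: P_def prod.remove [of UNIV k])
      then show ?thesis
        using s_pos [of k] by (intro divide_left_mono) auto
    qed
    ultimately show False
      using less by linarith
  qed
  then show ?thesis
    by (simp add: vec_eq_iff)
qed

text \<open>The polar depends on the position of the origin, which f moves, so the volumes are not
  transported along f. Instead the origin goes to an interior integral point, hence to the all-ones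
  vector, whose barycentric coordinates are 1/s_i and 1/P. Affine maps preserve these, and
  \<open>vol_product\<close> applies to the pulled-back vertices.\<close>

lemma vol_product_of_unimod_equiv_T_simplex:
  fixes S :: "(real^'n) set"
  assumes int: "0 \<in> interior S" and \<sigma>: "bij_betw \<sigma> (UNIV :: 'n set) {1..CARD('n)}"
    and equiv: "unimod_equiv S (T_simplex \<sigma>)"
  shows "(fact CARD('n))\<^sup>2 * vol S * vol (polar S) = (\<Prod>k=1..CARD('n). real (sylvester k))\<^sup>2"
proof -
  define s where "s = (\<lambda>i. real (sylvester (\<sigma> i)))"
  have s_pos: "0 < s i" for i
    by (simp add: s_def sylvester_pos)
  define P where "P = (\<Prod>i\<in>UNIV. s i)"
  have P_pos: "0 < P"
    unfolding P_def using s_pos by (intro prod_pos) auto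
  obtain A b where bij: "bij (\<lambda>x. A *v x + b)"
    and lattice: "(\<lambda>x. A *v x + b) ` {x. integral_point x} = {x. integral_point x}"
    and image: "(\<lambda>x. A *v x + b) ` S = T_simplex \<sigma>"
    using equiv unfolding unimod_equiv_def by blast
  define f where "f = (\<lambda>x. A *v x + b)"
  have inj: "inj ((*v) A)"
    using bij by (auto simp: bij_def inj_def)
  have "interior (f ` S) = f ` interior S"
  proof -
    have f: "f ` W = (+) b ` (*v) A ` W" for W
      by (simp add: f_def image_image add.commute)
    show ?thesis
      unfolding f interior_translation by (simp add: interior_injective_linear_image inj)
  qed
  then have "b \<in> interior (T_simplex \<sigma>)"
    using int image by (force simp: f_def image_iff)
  moreover have "integral_point b"
  proof -
    have "integral_point 0"
      by (simp add: integral_point_def)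
    then have "f 0 \<in> {x. integral_point x}"
      using lattice f_def by blast
    then show ?thesis
      by (simp add: f_def)
  qed
  ultimately have b: "b = 1"
    by (rule integral_point_interior_T_simplex [OF \<sigma>])
  define v0 where "v0 = inv f 0"
  define v where "v = (\<lambda>i. inv f (s i *\<^sub>R axis i 1))"
  have f_v0: "f v0 = 0" and f_v: "f (v i) = s i *\<^sub>R axis i 1" for i
    using bij by (auto simp: v0_def v_def f_def [symmetric] bij_def surj_f_inv_f)
  have "f ` (convex hull (insert v0 (range v))) = f ` S"
  proof -
    have "f ` (convex hull (insert v0 (range v))) = convex hull (f ` insert v0 (range v))"
      unfolding f_def by (rule convex_hull_affine_image)
    also have "f ` insert v0 (range v) = insert 0 (range (\<lambda>i. s i *\<^sub>R axis i 1))"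
      by (simp add: f_v0 f_v image_image)
    also have "convex hull \<dots> = f ` S"
      using image by (simp add: f_def T_simplex_eq s_def)
    finally show ?thesis .
  qed
  then have S: "S = convex hull (insert v0 (range v))"
    using bij inj_image_eq_iff [of f] by (auto simp: f_def [symmetric] bij_def)
  interpret barycentric_simplex v v0 "\<lambda>i. 1 / s i" "1 / P"
  proof
    show "1 / P + (\<Sum>i\<in>UNIV. 1 / s i) = 1"
      unfolding P_def s_def using sum_sylvester_reindex [OF \<sigma>] by simp
    then have sum: "1 / P + (\<Sum>i\<in>UNIV. 1 / s i) = 1" .
    \<comment> \<open>The linear part of f sends a vertex w to f w - b. The weights sum to 1, so b
      is subtracted exactly once from \<Sum> (1/s_i) s_i e_i, which is the all-ones vector
      b.\<close>
    have "A *v ((1 / P) *\<^sub>R v0 + (\<Sum>i\<in>UNIV. (1 / s i) *\<^sub>R v i))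
        = (1 / P) *\<^sub>R (f v0 - b) + (\<Sum>i\<in>UNIV. (1 / s i) *\<^sub>R (f (v i) - b))"
      by (simp add: f_def matrix_vector_right_distrib matrix_vector_mult_scaleR linear_sum [of "(*v) A"])
    also have "\<dots> = (\<Sum>i\<in>UNIV. axis i 1) - (1 / P + (\<Sum>i\<in>UNIV. 1 / s i)) *\<^sub>R b"
      using s_pos by (simp add: f_v0 f_v scaleR_diff_right sum_subtractf scaleR_sum_left scaleR_add_left
          less_imp_neq [symmetric])
    also have "\<dots> = 0"
      unfolding sum b by (simp add: vec_eq_iff axis_def)
    finally show "(1 / P) *\<^sub>R v0 + (\<Sum>i\<in>UNIV. (1 / s i) *\<^sub>R v i) = 0"
      using inj by (metis injD matrix_vector_mult_0_right)
    show "interior (convex hull insert v0 (range v)) \<noteq> {}"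
      using int S by auto
  qed (use s_pos P_pos in auto)
  have "(fact CARD('n))\<^sup>2 * vol S * vol (polar S) = 1 / (1 / P * (\<Prod>i\<in>UNIV. 1 / s i))"
    using vol_product by (simp only: S vertex_hull_def)
  also have "\<dots> = P\<^sup>2"
    by (simp add: prod_dividef P_def [symmetric] power2_eq_square)
  finally show ?thesis
    unfolding P_def s_def prod_sylvester_reindex [OF \<sigma>] .
qed

section \<open>Sorting the vertices and combining the bounds\<close>

lemma antimono_enumeration:
  fixes u :: "'a \<Rightarrow> real"
  assumes "finite V"
  obtains w where "bij_betw w {1..card V} V" "\<And>i. 1 \<le> i \<Longrightarrow> i < card V \<Longrightarrow> u (w (Suc i)) \<le> u (w i)"
proof -
  obtain xs where xs: "set xs = V" "distinct xs"
    using finite_distinct_list [OF assms] by blast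
  define ys where "ys = sort_key (\<lambda>x. - u x) xs"
  have ys: "set ys = V" "distinct ys" "length ys = card V" "sorted (map (\<lambda>x. - u x) ys)"
    using xs by (auto simp: ys_def distinct_card [symmetric])
  have "bij_betw (\<lambda>i. i - 1) {1..card V} {..<length ys}"
    by (rule bij_betw_byWitness [of _ Suc]) (auto simp: ys)
  then have "bij_betw ((!) ys \<circ> (\<lambda>i. i - 1)) {1..card V} V"
    by (rule bij_betw_trans) (auto intro: bij_betw_nth simp: ys)
  moreover have "u (((!) ys \<circ> (\<lambda>i. i - 1)) (Suc i)) \<le> u (((!) ys \<circ> (\<lambda>i. i - 1)) i)"
    if "1 \<le> i" "i < card V" for i
    using sorted_nth_mono [OF ys(4), of "i - 1" i] that by (simp add: ys(3))
  ultimately show thesis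
    by (rule that)
qed

theorem mainTheorem5:
  fixes S :: "(real^'n) set"
  assumes "S \<in> simplices_one"
    and "0 \<in> interior S"
  shows "real (CARD('n) + 1) ^ (CARD('n) + 1) \<le> (fact CARD('n))\<^sup>2 * vol S * vol (polar S)
    \<and> (fact CARD('n))\<^sup>2 * vol S * vol (polar S) \<le> (real (sylvester (CARD('n) + 1)) - 1)\<^sup>2
    \<and> (real (CARD('n) + 1) ^ (CARD('n) + 1) = (fact CARD('n))\<^sup>2 * vol S * vol (polar S)
           \<longleftrightarrow> centroid S = 0)
    \<and> ((fact CARD('n))\<^sup>2 * vol S * vol (polar S) = (real (sylvester (CARD('n) + 1)) - 1)\<^sup>2
           \<longleftrightarrow> (\<exists>\<sigma>. bij_betw \<sigma> (UNIV :: 'n set) {1..CARD('n)} \<and> unimod_equiv S (T_simplex \<sigma>)))"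
proof -
  let ?d = "CARD('n)"
  obtain V where V: "finite V" "card V = Suc ?d" "\<not> affine_dependent V"
    "\<And>v. v \<in> V \<Longrightarrow> integral_point v" "S = convex hull V"
    using assms(1) by (auto simp: simplices_one_def lattice_simplex_def)
  have "card {x \<in> interior S. integral_point x} = 1"
    using assms(1) by (simp add: simplices_one_def)
  moreover have "0 \<in> {x \<in> interior S. integral_point x}"
    using assms(2) by (simp add: integral_point_def)
  ultimately have unique: "x = 0" if "x \<in> interior S" "integral_point x" for x
    using that by (metis (mono_tags, lifting) card_1_singletonE mem_Collect_eq singletonD)
  obtain u where u: "\<And>x. x \<in> V \<Longrightarrow> 0 < u x" "sum u V = 1" "(\<Sum>x\<in>V. u x *\<^sub>R x) = 0"
    using assms(2) V by (auto simp: interior_convex_hull_explicit_minimal split: if_splits)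
  obtain w where w: "bij_betw w {1..Suc ?d} V" "\<And>i. 1 \<le> i \<Longrightarrow> i < Suc ?d \<Longrightarrow> u (w (Suc i)) \<le> u (w i)"
    using antimono_enumeration [OF V(1), of u] V(2) by metis
  \<comment> \<open>Any enumeration of the coordinates will do; it also serves as the witness in the
    equality case of the upper bound.\<close>
  obtain \<sigma> where \<sigma>: "bij_betw \<sigma> (UNIV :: 'n set) {1..?d}"
    using finite_same_card_bij [of "UNIV :: 'n set" "{1..?d}"] by auto
  have w_V: "w k \<in> V" if "1 \<le> k" "k \<le> Suc ?d" for k
    using w(1) that by (auto simp: bij_betw_def)
  have \<sigma>_range: "1 \<le> \<sigma> i" "\<sigma> i \<le> ?d" for i
    using bij_betwE [OF \<sigma>] by auto
  define x where "x = (\<lambda>k. u (w k))"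
  define v where "v = (\<lambda>i. w (\<sigma> i))"
  \<comment> \<open>The vertex with the smallest coordinate is set aside, so each initial segment of
    length at most d corresponds to a set of indices of \<open>v\<close>.\<close>
  define v0 where "v0 = w (Suc ?d)"
  have V_eq: "V = insert v0 (range v)"
  proof -
    have "V = w ` insert (Suc ?d) {1..?d}"
      using w(1) by (simp add: bij_betw_def atLeastAtMostSuc_conv)
    moreover have "{1..?d} = range \<sigma>"
      using \<sigma> by (simp add: bij_betw_def)
    ultimately show ?thesis
      by (simp add: v0_def v_def image_image)
  qed
  have sum_split: "(\<Sum>a\<in>V. h a) = h v0 + (\<Sum>i\<in>UNIV. h (v i))" for h :: "real^'n \<Rightarrow> 'b::comm_monoid_add"
  proof -
    have "(\<Sum>a\<in>V. h a) = (\<Sum>k=1..Suc ?d. h (w k))"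
      by (rule sum.reindex_bij_betw [OF w(1), symmetric])
    also have "\<dots> = h v0 + (\<Sum>k=1..?d. h (w k))"
      by (simp add: v0_def add.commute)
    also have "(\<Sum>k=1..?d. h (w k)) = (\<Sum>i\<in>UNIV. h (v i))"
      unfolding v_def by (rule sum.reindex_bij_betw [OF \<sigma>, symmetric])
    finally show ?thesis .
  qed
  interpret barycentric_simplex v v0 "\<lambda>i. u (v i)" "u v0"
  proof
    show "u v0 + (\<Sum>i\<in>UNIV. u (v i)) = 1" "u v0 *\<^sub>R v0 + (\<Sum>i\<in>UNIV. u (v i) *\<^sub>R v i) = 0"
      using sum_split [of u] sum_split [of "\<lambda>a. u a *\<^sub>R a"] u by simp_all
    show "interior (convex hull insert v0 (range v)) \<noteq> {}"
      using assms(2) V V_eq by auto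
  qed (use u V_eq in auto)
  have S: "vertex_hull = S"
    by (simp add: vertex_hull_def V V_eq [symmetric])
  have unique_hull: "a = 0" if "a \<in> interior vertex_hull" "integral_point a" for a
    using that unfolding S by (rule unique)
  have integral: "integral_point (v i)" "integral_point v0" for i
    using V(4) V_eq by auto
  have x_pos: "0 < x k" if "1 \<le> k" "k \<le> Suc ?d" for k
    using u(1) w_V that by (simp add: x_def)
  have x_sum: "(\<Sum>k=1..Suc ?d. x k) = 1"
    unfolding x_def using sum.reindex_bij_betw [OF w(1), of u] u(2) by simp
  have x_decr: "x (Suc k) \<le> x k" if "1 \<le> k" "k \<le> ?d" for k
    using w(2) that by (simp add: x_def)
  have sum_prod: "(\<Sum>k=1..m. x k) + (\<Prod>k=1..m. x k) \<le> 1" if "1 \<le> m" "m \<le> ?d" for m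
  proof -
    \<comment> \<open>The set J for which \<open>product_sum_le\<close> is used consists of the
      indices of the m largest coordinates, apart from ties.\<close>
    have "bij_betw \<sigma> {i. \<sigma> i \<le> m} {1..m}"
    proof (rule bij_betw_subset [OF \<sigma>])
      have "range \<sigma> = {1..?d}"
        using \<sigma> by (simp add: bij_betw_def)
      moreover have "\<sigma> ` {i. \<sigma> i \<le> m} = range \<sigma> \<inter> {..m}"
        by auto
      ultimately have "\<sigma> ` {i. \<sigma> i \<le> m} = {1..?d} \<inter> {..m}"
        by simp
      then show "\<sigma> ` {i. \<sigma> i \<le> m} = {1..m}"
        using that by auto
    qed simp
    from sum.reindex_bij_betw [OF this, of x] prod.reindex_bij_betw [OF this, of x]
    have eq: "(\<Sum>k=1..m. x k) = (\<Sum>i | \<sigma> i \<le> m. u (v i))" "(\<Prod>k=1..m. x k) = (\<Prod>i | \<sigma> i \<le> m. u (v i))"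
      by (simp_all add: x_def v_def)
    show ?thesis
      unfolding eq by (rule product_sum_le [OF integral(1) unique_hull])
  qed
  define P where "P = (\<Prod>k=1..?d. real (sylvester k))"
  have P_pos: "0 < P"
    unfolding P_def by (intro prod_pos) (simp add: sylvester_pos)
  have P_eq: "real (sylvester (?d + 1)) - 1 = P"
    by (simp add: P_def sylvester_Suc)
  have prod_x: "(\<Prod>k=1..Suc ?d. x k) = u v0 * (\<Prod>i\<in>UNIV. u (v i))"
    using prod.reindex_bij_betw [OF \<sigma>, of x] by (simp add: x_def v_def v0_def mult.commute)
  have vol: "(fact ?d)\<^sup>2 * vol S * vol (polar S) = 1 / (\<Prod>k=1..Suc ?d. x k)"
    using vol_product by (simp only: S prod_x)
  have x_prod_pos: "0 < (\<Prod>k=1..Suc ?d. x k)"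
    using x_pos by (intro prod_pos) auto
  have lower: "real (?d + 1) ^ (?d + 1) \<le> (fact ?d)\<^sup>2 * vol S * vol (polar S)"
    using vol_product_ge by (simp only: vol prod_x)
  have lower_eq: "real (?d + 1) ^ (?d + 1) = (fact ?d)\<^sup>2 * vol S * vol (polar S) \<longleftrightarrow> centroid S = 0"
    using vol_product_eq_lower_iff centroid_eq_0_iff by (simp only: S vol prod_x)
  have x_ge: "1 / P\<^sup>2 \<le> (\<Prod>k=1..Suc ?d. x k)"
    unfolding P_def using x_pos x_decr x_sum sum_prod by (rule prod_ge_sylvester)
  have upper: "(fact ?d)\<^sup>2 * vol S * vol (polar S) \<le> P\<^sup>2"
    unfolding vol using x_ge x_prod_pos P_pos by (simp add: divide_le_eq mult.commute)
  have equiv: "unimod_equiv S (T_simplex \<sigma>)" if "(fact ?d)\<^sup>2 * vol S * vol (polar S) = P\<^sup>2"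
  proof -
    have "(\<Prod>k=1..Suc ?d. x k) = 1 / P\<^sup>2"
      using that unfolding vol by (metis div_by_1 divide_divide_eq_right mult_1)
    then have x_eq: "x k = (if k \<le> ?d then 1 / real (sylvester k) else 1 / P)" if "1 \<le> k" "k \<le> Suc ?d" for k
      unfolding P_def using x_pos x_decr x_sum sum_prod that by (intro prod_eq_sylvesterD) auto
    have u_v: "u (v i) = 1 / real (sylvester (\<sigma> i))" for i
      using x_eq [of "\<sigma> i"] \<sigma>_range [of i] by (simp add: x_def v_def)
    have u_v0: "u v0 = 1 / (\<Prod>i\<in>UNIV. real (sylvester (\<sigma> i)))"
      using x_eq [of "Suc ?d"] by (simp add: x_def v0_def P_def prod_sylvester_reindex [OF \<sigma>])
    have "unimod_equiv vertex_hull (T_simplex \<sigma>)"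
      unfolding T_simplex_eq
      by (rule unimod_equiv_axis_simplex [OF sylvester_pos u_v u_v0 integral unique_hull])
    then show ?thesis
      by (simp only: S)
  qed
  show ?thesis
    using lower lower_eq upper equiv \<sigma> vol_product_of_unimod_equiv_T_simplex [OF assms(2)]
    unfolding P_eq P_def by blast
qed

end
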